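(* Let $M$ be an $n$-dimensional $\mathcal{C}^1$ manifold with $n\ge1$, let $(A,\nu,T)$ be an ergodic dynamical system preserving a probability measure $\nu$, and let $v\in\mathcal{C}^1(M,\mathbb{R}_+^* )$. Let $(\Omega,(g_t)_{t\ge0})$ be the semi-flow on $\Omega=\widetilde{A}\times M$ given by $g_t(x,y)=(g_t^{v(y)}(x),y)$, where $(g_t^{w})_{t\ge0}$ denotes the suspension semi-flow over $(A,\nu,T)$ with constant roof $1$ and speed $w$. Let $\mu$ be an absolutely continuous compatible probability measure on $\Omega$. If $\mathrm{Leb}(\{\mathrm{d}v=0\})=0$ on $M$, then $(\Omega,\mu,(g_t)_{t\ge0})$ exhibits Keplerian shear.
   Context: $\mathbb{R}_+^*=(0,+\infty)$. Suspension: given $(A,\nu,T)$ and $w>0$, put $\widetilde{A}:=(A\times[0,1])/_{(x,1)\sim(T(x),0)}$, $g_t^w[(x,s)]=[(x,s+wt)]$ (that is, on the fundamental domain $A\times[0,1)$, $g_t^w(x,s)=(T^{\lfloor s+wt\rfloor}x,\,s+wt-\lfloor s+wt\rfloor)$), and $\tilde\nu:=\nu\otimes\mathrm{Leb}$ on the fundamental domain $A\times[0,1)$. A probability measure $\mu$ on $\Omega=\widetilde{A}\times M$ is compatible if $\mu=\tilde\nu\otimes\tilde\mu$ for some probability measure $\tilde\mu$ on $M$; compatible measures are preserved by $(g_t)$. It is absolutely continuous if $\tilde\mu$ is absolutely continuous with respect to Lebesgue measure (in charts) on $M$. "$\mathrm{Leb}(B)=0$" means $B\subset M$ has zero Lebesgue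 measure in charts. Keplerian shear: a (semi-)flow $(\Omega,\mu,(g_t))$ preserving a probability measure $\mu$ exhibits Keplerian shear if for all $f\in\mathbb{L}^2(\Omega,\mu)$, $f\circ g_t\to\mathbb{E}_\mu(f\mid\mathcal{I})$ as $t\to+\infty$, weakly in $\mathbb{L}^2(\Omega,\mu)$, where $\mathcal{I}$ is the $\sigma$-algebra of invariant measurable sets (sets $B$ with $g_t^{-1}(B)=B$ for all $t\geq 0$, up to $\mu$-null sets). *)

theory Defs
  imports "HOL-Probability.Probability"
begin

section \<open>Manifolds of class C1\<close>

definition C1_on :: "'e::real_normed_vector set \<Rightarrow> ('e \<Rightarrow> 'f::real_normed_vector) \<Rightarrow> bool" where
  "C1_on S f \<longleftrightarrow>
     (\<exists>f' :: 'e \<Rightarrow> 'e \<Rightarrow>\<^sub>L 'f.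
        (\<forall>x\<in>S. (f has_derivative blinfun_apply (f' x)) (at x)) \<and> continuous_on S f')"

text \<open>A chart is a pair of a domain and a coordinate map, of which only the values on the
  domain matter. The manifold is the whole type; that it is Hausdorff and second countable is
  expressed by the sorts of the type where the manifold is fixed. An atlas need not be maximal:
  all notions below are the same for any two compatible atlases.\<close>

type_synonym ('m, 'e) chart = "'m set \<times> ('m \<Rightarrow> 'e)"

definition is_chart :: "('m::topological_space, 'e::euclidean_space) chart \<Rightarrow> bool" where
  "is_chart c \<longleftrightarrow> (case c of (U, \<phi>) \<Rightarrow>
     open U \<and> open (\<phi> ` U) \<and> homeomorphism U (\<phi> ` U) \<phi> (inv_into U \<phi>))"

definition C1_atlas :: "('m::topological_space, 'e::euclidean_space) chart set \<Rightarrow> bool" where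
  "C1_atlas \<A> \<longleftrightarrow>
     (\<forall>c\<in>\<A>. is_chart c) \<and>
     (\<Union>(U, \<phi>)\<in>\<A>. U) = UNIV \<and>
     (\<forall>(U, \<phi>)\<in>\<A>. \<forall>(V, \<psi>)\<in>\<A>. C1_on (\<phi> ` (U \<inter> V)) (\<psi> \<circ> inv_into U \<phi>))"

definition C1_manifold_fun ::
  "('m::topological_space, 'e::euclidean_space) chart set \<Rightarrow> ('m \<Rightarrow> real) \<Rightarrow> bool" where
  "C1_manifold_fun \<A> v \<longleftrightarrow> (\<forall>(U, \<phi>)\<in>\<A>. C1_on (\<phi> ` U) (v \<circ> inv_into U \<phi>))"

definition critical_points ::
  "('m::topological_space, 'e::euclidean_space) chart set \<Rightarrow> ('m \<Rightarrow> real) \<Rightarrow> 'm set" where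
  "critical_points \<A> v =
     {y. \<forall>(U, \<phi>)\<in>\<A>. y \<in> U \<longrightarrow> ((v \<circ> inv_into U \<phi>) has_derivative (\<lambda>_. 0)) (at (\<phi> y))}"

definition Leb_null ::
  "('m::topological_space, 'e::euclidean_space) chart set \<Rightarrow> 'm set \<Rightarrow> bool" where
  "Leb_null \<A> B \<longleftrightarrow> (\<forall>(U, \<phi>)\<in>\<A>. \<phi> ` (B \<inter> U) \<in> null_sets lebesgue)"


section \<open>Ergodic systems and their suspensions\<close>

definition ergodic_system :: "'a measure \<Rightarrow> ('a \<Rightarrow> 'a) \<Rightarrow> bool" where
  "ergodic_system \<nu> T \<longleftrightarrow>
     prob_space \<nu> \<and> T \<in> measurable \<nu> \<nu> \<and> distr \<nu> \<nu> T = \<nu> \<and>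
     (\<forall>B\<in>sets \<nu>. T -` B \<inter> space \<nu> = B \<longrightarrow> measure \<nu> B = 0 \<or> measure \<nu> B = 1)"

text \<open>The suspension with constant roof 1 is represented on the fundamental domain
  \<open>A \<times> [0,1)\<close>, which contains exactly one point of each class of
  \<open>A \<times> [0,1]\<close> modulo \<open>(x,1) \<sim> (T x,0)\<close>.\<close>

definition suspension_measure :: "'a measure \<Rightarrow> ('a \<times> real) measure" where
  "suspension_measure \<nu> = \<nu> \<Otimes>\<^sub>M restrict_space lborel {0..<1}"

definition suspension_flow :: "('a \<Rightarrow> 'a) \<Rightarrow> real \<Rightarrow> real \<Rightarrow> 'a \<times> real \<Rightarrow> 'a \<times> real" where
  "suspension_flow T w t = (\<lambda>(x, s).
     ((T ^^ nat \<lfloor>s + w * t\<rfloor>) x, s + w * t - of_int \<lfloor>s + w * t\<rfloor>))"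

definition fibred_flow ::
  "('a \<Rightarrow> 'a) \<Rightarrow> ('m \<Rightarrow> real) \<Rightarrow> real \<Rightarrow> ('a \<times> real) \<times> 'm \<Rightarrow> ('a \<times> real) \<times> 'm" where
  "fibred_flow T v t = (\<lambda>(x, y). (suspension_flow T (v y) t x, y))"

definition ac_compatible ::
  "('m::topological_space, 'e::euclidean_space) chart set \<Rightarrow> 'a measure \<Rightarrow>
   (('a \<times> real) \<times> 'm) measure \<Rightarrow> bool" where
  "ac_compatible \<A> \<nu> \<mu> \<longleftrightarrow>
     (\<exists>\<rho> :: 'm measure. prob_space \<rho> \<and> sets \<rho> = sets borel \<and>
        \<mu> = suspension_measure \<nu> \<Otimes>\<^sub>M \<rho> \<and>
        (\<forall>B\<in>sets borel. Leb_null \<A> B \<longrightarrow> B \<in> null_sets \<rho>))"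


section \<open>Keplerian shear\<close>

definition pmp_semiflow :: "'w measure \<Rightarrow> (real \<Rightarrow> 'w \<Rightarrow> 'w) \<Rightarrow> bool" where
  "pmp_semiflow \<mu> g \<longleftrightarrow>
     prob_space \<mu> \<and>
     (\<forall>t\<ge>0. g t \<in> measurable \<mu> \<mu> \<and> distr \<mu> \<mu> (g t) = \<mu>) \<and>
     (\<forall>z\<in>space \<mu>. g 0 z = z) \<and>
     (\<forall>s\<ge>0. \<forall>t\<ge>0. \<forall>z\<in>space \<mu>. g (s + t) z = g s (g t z))"

text \<open>Only the \<open>\<sigma>\<close>-algebra of this measure is used.\<close>

definition invariant_algebra :: "'w measure \<Rightarrow> (real \<Rightarrow> 'w \<Rightarrow> 'w) \<Rightarrow> 'w measure" where
  "invariant_algebra \<mu> g = sigma (space \<mu>)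
     {B \<in> sets \<mu>. \<forall>t\<ge>0. sym_diff (g t -` B \<inter> space \<mu>) B \<in> null_sets \<mu>}"

definition square_integrable :: "'w measure \<Rightarrow> ('w \<Rightarrow> real) \<Rightarrow> bool" where
  "square_integrable \<mu> f \<longleftrightarrow> f \<in> borel_measurable \<mu> \<and> integrable \<mu> (\<lambda>z. (f z)\<^sup>2)"

definition weakly_tends_L2 ::
  "'w measure \<Rightarrow> (real \<Rightarrow> 'w \<Rightarrow> real) \<Rightarrow> ('w \<Rightarrow> real) \<Rightarrow> bool" where
  "weakly_tends_L2 \<mu> F f \<longleftrightarrow>
     (\<forall>h. square_integrable \<mu> h \<longrightarrow>
        ((\<lambda>t. \<integral>z. F t z * h z \<partial>\<mu>) \<longlongrightarrow> (\<integral>z. f z * h z \<partial>\<mu>)) at_top)"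

definition keplerian_shear :: "'w measure \<Rightarrow> (real \<Rightarrow> 'w \<Rightarrow> 'w) \<Rightarrow> bool" where
  "keplerian_shear \<mu> g \<longleftrightarrow>
     pmp_semiflow \<mu> g \<and>
     (\<forall>f. square_integrable \<mu> f \<longrightarrow>
        weakly_tends_L2 \<mu> (\<lambda>t. f \<circ> g t) (real_cond_exp \<mu> (invariant_algebra \<mu> g) f))"

end

theory Submission
  imports Defs
begin

text \<open>Fix a point \<open>(x, s)\<close> of the suspension and look at the trajectories that start on the fibre
over it. Up to time \<open>t\<close> the one through \<open>y\<close> has covered the length \<open>v y * t\<close>, so a set \<open>E \<times> B\<close> is
seen at time \<open>t\<close> from \<open>((x, s), y)\<close> iff \<open>y \<in> B\<close> and \<open>q (s + v y * t) = 1\<close>, where \<open>q u\<close> tells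
whether the unit speed orbit of \<open>(x, 0)\<close> lies in \<open>E\<close> at time \<open>u\<close>. Two facts make the average of
this over \<open>y\<close> converge.

First, the orbit function \<open>q\<close> has a mean: its averages over \<open>[0, R]\<close> tend, for almost every \<open>x\<close>,
to the measure of \<open>E\<close>. On integer times this is Birkhoff's theorem for \<open>T\<close> and the bounded function
that integrates \<open>E\<close> over the roof (\<open>birkhoff_ergodic_bounded\<close>, \<open>suspension_orbit_has_mean\<close>).

Second, the distribution of \<open>v\<close> is absolutely continuous. Around a point where \<open>dv \<noteq> 0\<close> the function
\<open>v\<close> can be taken as a coordinate, so the preimage of a null set is null there, and the other points
are negligible by hypothesis (\<open>Leb_null_preimage\<close>). An integral of \<open>q (s + v y * t)\<close> against an
integrable weight in \<open>y\<close> is thus an integral of \<open>q (s + w * t)\<close> against an integrable density in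
\<open>w\<close>. If that density is the indicator of an interval, a change of variables turns the integral
into an average of \<open>q\<close> over a long interval, which tends to the mean; general densities
follow by approximation (\<open>has_mean_speed\<close>). Dominated convergence then gives the weak limit of the
indicators of sets \<open>E \<times> B\<close> (\<open>fibred_flow_shear_rectangle\<close>): it is the measure of \<open>E\<close> times the
indicator of \<open>B\<close>, a function of \<open>y\<close> alone.

It remains to pass to all of \<open>L\<^sup>2\<close>. A weak limit that is measurable with respect to the invariant
\<open>\<sigma>\<close>-algebra has to be the conditional expectation, since integrals over an invariant set do not
change along the flow. Hence the claim holds for the rectangles \<open>E \<times> B\<close>; these
generate the \<open>\<sigma>\<close>-algebra, and both sides of the claim are bounded linear in \<open>f \<in> L\<^sup>2\<close>, uniformly in
\<open>t\<close> (\<open>vanishing_from_generator\<close>, \<open>keplerian_shear_generator\<close>).\<close>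

section \<open>The speed has an absolutely continuous distribution\<close>

lemma null_sets_coordinate_preimage:
  fixes b :: "'e::euclidean_space"
  assumes b: "b \<in> Basis" and B: "B \<in> null_sets lborel"
  shows "{z::'e. z \<bullet> b \<in> B} \<in> null_sets lborel"
proof -
  have [measurable]: "B \<in> sets borel" using B by auto
  have B0: "emeasure lborel B = 0" using B by auto
  have meas: "{z::'e. z \<bullet> b \<in> B} \<in> sets borel" by measurable
  \<comment> \<open>writes the indicator as a product over the coordinates, with a factor of integral 0 at \<open>b\<close>\<close>
  define \<phi> where "\<phi> = (\<lambda>c r. if c = b then indicator B r else 1 :: ennreal)"
  have "(\<integral>\<^sup>+z. indicator {z::'e. z \<bullet> b \<in> B} z \<partial>lborel) = (\<integral>\<^sup>+z. (\<Prod>c\<in>(Basis::'e set). \<phi> c (z \<bullet> c)) \<partial>lborel)"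
  proof (rule nn_integral_cong)
    fix z :: 'e
    have "(\<Prod>c\<in>Basis. \<phi> c (z \<bullet> c)) = \<phi> b (z \<bullet> b) * (\<Prod>c\<in>Basis - {b}. \<phi> c (z \<bullet> c))"
      using b by (simp add: prod.remove)
    also have "(\<Prod>c\<in>Basis - {b}. \<phi> c (z \<bullet> c)) = 1" by (intro prod.neutral) (auto simp: \<phi>_def)
    finally show "indicator {z::'e. z \<bullet> b \<in> B} z = (\<Prod>c\<in>Basis. \<phi> c (z \<bullet> c))"
      by (simp add: \<phi>_def indicator_def)
  qed
  also have "\<dots> = (\<Prod>c\<in>(Basis::'e set). \<integral>\<^sup>+r. \<phi> c r \<partial>lborel)"
    by (intro nn_integral_lborel_prod) (auto simp: \<phi>_def)
  also have "\<dots> = 0"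
  proof (intro prod_zero bexI[OF _ b])
    show "(\<integral>\<^sup>+r. \<phi> b r \<partial>lborel) = 0" using B0 by (simp add: \<phi>_def)
  qed auto
  finally show ?thesis using meas by (auto simp: null_sets_def)
qed

text \<open>The map \<open>x \<mapsto> x + (f x - x \<bullet> b) *\<^sub>R b\<close> replaces the coordinate of \<open>x\<close> along \<open>b\<close> by the value \<open>f x\<close>.
Two points with the same image differ by a multiple of \<open>b\<close> and have the same value under \<open>f\<close>, which
the mean value theorem on the segment between them forbids.\<close>

lemma inj_on_shear:
  fixes f :: "'e::euclidean_space \<Rightarrow> real"
  assumes W: "convex W" and b: "b \<in> Basis"
    and der: "\<And>x. x \<in> W \<Longrightarrow> (f has_derivative f' x) (at x)"
    and nz: "\<And>x. x \<in> W \<Longrightarrow> f' x b \<noteq> 0"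
  shows "inj_on (\<lambda>x. x + (f x - x \<bullet> b) *\<^sub>R b) W"
proof (rule inj_onI)
  fix x y assume x: "x \<in> W" and y: "y \<in> W"
    and eq: "x + (f x - x \<bullet> b) *\<^sub>R b = y + (f y - y \<bullet> b) *\<^sub>R b"
  have fxy: "f x = f y"
    using arg_cong[OF eq, of "\<lambda>u. u \<bullet> b"] b by (simp add: inner_add_left inner_Basis)
  define r where "r = y \<bullet> b - x \<bullet> b"
  have yx: "y = x + r *\<^sub>R b"
    using eq fxy by (simp add: r_def algebra_simps)
  define h where "h = (\<lambda>s. f (x + s *\<^sub>R (r *\<^sub>R b)))"
  have seg: "x + s *\<^sub>R (r *\<^sub>R b) \<in> W" if "0 \<le> s" "s \<le> 1" for s
  proof -
    have "(1 - s) *\<^sub>R x + s *\<^sub>R y \<in> W"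
      using W x y that by (simp add: convex_alt)
    then show ?thesis by (simp add: yx algebra_simps)
  qed
  have "\<exists>s\<in>{0<..<1}. h 1 - h 0 = f' (x + s *\<^sub>R (r *\<^sub>R b)) ((1 - 0) *\<^sub>R (r *\<^sub>R b))"
  proof (rule mvt_simple)
    fix s :: real assume "0 \<le> s" "s \<le> 1"
    then have "(f has_derivative f' (x + s *\<^sub>R (r *\<^sub>R b))) (at (x + s *\<^sub>R (r *\<^sub>R b)))"
      by (intro der seg)
    moreover have "((\<lambda>s. x + s *\<^sub>R (r *\<^sub>R b)) has_derivative (\<lambda>d. d *\<^sub>R (r *\<^sub>R b))) (at s)"
      by (auto intro!: derivative_eq_intros)
    ultimately have "(h has_derivative (\<lambda>d. f' (x + s *\<^sub>R (r *\<^sub>R b)) (d *\<^sub>R (r *\<^sub>R b)))) (at s)"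
      unfolding h_def by (rule has_derivative_compose[rotated])
    then show "(h has_derivative (\<lambda>d. f' (x + s *\<^sub>R (r *\<^sub>R b)) (d *\<^sub>R (r *\<^sub>R b)))) (at s within {0..1})"
      by (rule has_derivative_at_withinI)
  qed simp
  then obtain s where s: "s \<in> {0<..<1}" "h 1 - h 0 = f' (x + s *\<^sub>R (r *\<^sub>R b)) (r *\<^sub>R b)" by auto
  have inW: "x + s *\<^sub>R (r *\<^sub>R b) \<in> W" using s by (intro seg) auto
  interpret bounded_linear "f' (x + s *\<^sub>R (r *\<^sub>R b))" using der[OF inW] by (rule has_derivative_bounded_linear)
  have "h 1 - h 0 = 0" using fxy by (simp add: h_def yx[symmetric])
  then have "r * f' (x + s *\<^sub>R (r *\<^sub>R b)) b = 0" using s(2) scaleR[of r b] by simp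
  then have "r = 0" using nz[OF inW] by simp
  then show "x = y" using yx by simp
qed

text \<open>Near a point where some partial derivative along \<open>b\<close> does not vanish, the map of the previous lemma
is a diffeomorphism that carries \<open>f -` B\<close> into the set of points whose coordinate along \<open>b\<close> lies in
\<open>B\<close>. That set is null, and the differentiable inverse map sends null sets to null sets.\<close>

lemma negligible_noncritical_preimage:
  fixes f :: "'e::euclidean_space \<Rightarrow> real" and f' :: "'e \<Rightarrow> 'e \<Rightarrow>\<^sub>L real"
  assumes S: "open S"
    and der: "\<And>x. x \<in> S \<Longrightarrow> (f has_derivative blinfun_apply (f' x)) (at x)"
    and cont: "continuous_on S f'"
    and B: "B \<in> null_sets lborel"
  shows "negligible {x\<in>S. f' x \<noteq> 0 \<and> f x \<in> B}"
proof (subst locally_negligible_alt, intro ballI)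
  fix x assume "x \<in> {x\<in>S. f' x \<noteq> 0 \<and> f x \<in> B}"
  then have x: "x \<in> S" "f' x \<noteq> 0" "f x \<in> B" by auto
  from x(2) obtain b where b: "b \<in> Basis" "f' x b \<noteq> 0"
    by (metis blinfun_euclidean_eqI zero_blinfun.rep_eq)
  have "continuous_on S (\<lambda>z. f' z b)" by (intro continuous_intros cont)
  then have "open (S \<inter> (\<lambda>z. f' z b) -` (- {0}))"
    using S by (intro continuous_open_preimage) auto
  moreover have "x \<in> S \<inter> (\<lambda>z. f' z b) -` (- {0})" using x b by auto
  ultimately obtain r where r: "r > 0" "ball x r \<subseteq> S \<inter> (\<lambda>z. f' z b) -` (- {0})"
    by (meson open_contains_ball)
  define W where "W = ball x r"
  have WS: "z \<in> S" and Wnz: "f' z b \<noteq> 0" if "z \<in> W" for z using r that by (auto simp: W_def)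
  define \<Phi> where "\<Phi> = (\<lambda>z. z + (f z - z \<bullet> b) *\<^sub>R b)"
  have inj: "inj_on \<Phi> W"
    unfolding \<Phi>_def by (rule inj_on_shear[where f' = f']) (use b der WS Wnz in \<open>auto simp: W_def\<close>)
  have d\<Phi>: "(\<Phi> has_derivative (\<lambda>h. h + (f' z h - h \<bullet> b) *\<^sub>R b)) (at z)" if "z \<in> W" for z
    unfolding \<Phi>_def using der[OF WS[OF that]] by (auto intro!: derivative_eq_intros)
  have c\<Phi>: "continuous_on W \<Phi>"
    using d\<Phi> by (intro continuous_at_imp_continuous_on ballI) (rule has_derivative_continuous)
  define G where "G = inv_into W \<Phi>"
  have GF: "G (\<Phi> z) = z" if "z \<in> W" for z using inj that by (simp add: G_def)
  have dG: "(G has_derivative (\<lambda>k. k + ((k \<bullet> b - f' z k) / f' z b) *\<^sub>R b)) (at (\<Phi> z))" if "z \<in> W" for z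
  proof (rule has_derivative_inverse_strong[OF _ that c\<Phi> GF d\<Phi>[OF that]])
    \<comment> \<open>the component of the preimage of \<open>k\<close> along \<open>b\<close> is found by solving a linear equation with leading coefficient \<open>f\' z b\<close>\<close>
    show "(\<lambda>h. h + (f' z h - h \<bullet> b) *\<^sub>R b) \<circ> (\<lambda>k. k + ((k \<bullet> b - f' z k) / f' z b) *\<^sub>R b) = id"
      using Wnz[OF that] b
      by (auto simp: fun_eq_iff blinfun.add_right blinfun.scaleR_right inner_add_left inner_Basis)
  qed (simp add: W_def)
  define U where "U = {x\<in>S. f' x \<noteq> 0 \<and> f x \<in> B} \<inter> W"
  have "\<Phi> ` U \<subseteq> {z. z \<bullet> b \<in> B}"
    using b by (auto simp: \<Phi>_def U_def inner_add_left inner_Basis)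
  moreover have "negligible {z. z \<bullet> b \<in> B}"
    using null_sets_coordinate_preimage[OF b(1) B] null_sets_completionI
    by (auto simp: negligible_iff_null_sets)
  ultimately have "negligible (\<Phi> ` U)" by (rule negligible_subset[rotated])
  moreover have "G differentiable_on \<Phi> ` U"
    unfolding differentiable_on_def
  proof
    fix w assume "w \<in> \<Phi> ` U"
    then obtain z where "z \<in> W" "w = \<Phi> z" by (auto simp: U_def)
    then show "G differentiable at w within \<Phi> ` U"
      using dG differentiable_at_withinI differentiableI by blast
  qed
  ultimately have "negligible (G ` \<Phi> ` U)"
    by (rule negligible_differentiable_image_negligible[OF order_refl])
  moreover have "G ` \<Phi> ` U = U" using GF by (force simp: U_def image_iff)
  ultimately have "negligible U" by simp
  moreover have "openin (top_of_set {x\<in>S. f' x \<noteq> 0 \<and> f x \<in> B}) U" unfolding U_def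
    by (intro openin_open_Int) (simp add: W_def)
  moreover have "x \<in> U" using x r by (auto simp: U_def W_def)
  ultimately show "\<exists>U. openin (top_of_set {x\<in>S. f' x \<noteq> 0 \<and> f x \<in> B}) U \<and> x \<in> U \<and> negligible U"
    by blast
qed

lemma atlas_chartD:
  assumes "C1_atlas \<A>" "(U, \<phi>) \<in> \<A>"
  shows "open U" "open (\<phi> ` U)" "continuous_on U \<phi>" "inj_on \<phi> U" "continuous_on (\<phi> ` U) (inv_into U \<phi>)"
proof -
  have c: "is_chart (U, \<phi>)" using assms by (auto simp: C1_atlas_def)
  then have h: "homeomorphism U (\<phi> ` U) \<phi> (inv_into U \<phi>)" by (simp add: is_chart_def)
  show "open U" "open (\<phi> ` U)" using c by (auto simp: is_chart_def)
  show "continuous_on U \<phi>" "continuous_on (\<phi> ` U) (inv_into U \<phi>)" using h by (auto simp: homeomorphism_def)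
  show "inj_on \<phi> U" using h by (metis homeomorphism_def inj_on_inverseI)
qed

lemma atlas_cover:
  assumes "C1_atlas \<A>"
  obtains U \<phi> where "(U, \<phi>) \<in> \<A>" "y \<in> U"
  using assms unfolding C1_atlas_def by blast

lemma C1_manifold_fun_continuous:
  fixes \<A> :: "('m::t2_space, 'e::euclidean_space) chart set"
  assumes "C1_atlas \<A>" "C1_manifold_fun \<A> v"
  shows "continuous_on UNIV v"
proof (rule continuous_at_imp_continuous_on, intro ballI)
  fix y :: 'm
  obtain U \<phi> where c: "(U, \<phi>) \<in> \<A>" "y \<in> U" using atlas_cover[OF assms(1)] .
  note ch = atlas_chartD[OF assms(1) c(1)]
  have "C1_on (\<phi> ` U) (v \<circ> inv_into U \<phi>)" using assms(2) c(1) by (auto simp: C1_manifold_fun_def)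
  then have "continuous_on (\<phi> ` U) (v \<circ> inv_into U \<phi>)"
    unfolding C1_on_def by (metis continuous_at_imp_continuous_on has_derivative_continuous)
  then have "continuous_on U ((v \<circ> inv_into U \<phi>) \<circ> \<phi>)"
    using ch(3) continuous_on_compose by blast
  then have "continuous_on U v"
    by (rule continuous_on_eq) (use ch(4) in auto)
  then show "continuous (at y) v" using ch(1) c(2) by (simp add: continuous_on_eq_continuous_at)
qed

text \<open>\<open>critical_points\<close> asks for a vanishing derivative in every chart. By the chain rule one chart is
enough, because the changes of charts are differentiable.\<close>

lemma critical_in_chart:
  assumes at: "C1_atlas \<A>" and c: "(U, \<phi>) \<in> \<A>" and y: "y \<in> U"
    and d0: "((v \<circ> inv_into U \<phi>) has_derivative (\<lambda>_. 0)) (at (\<phi> y))"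
  shows "y \<in> critical_points \<A> v"
  unfolding critical_points_def
proof (intro CollectI ballI, clarify)
  fix V \<psi> assume c': "(V, \<psi>) \<in> \<A>" and yV: "y \<in> V"
  note ch = atlas_chartD[OF at c] and ch' = atlas_chartD[OF at c']
  have "C1_on (\<psi> ` (V \<inter> U)) (\<phi> \<circ> inv_into V \<psi>)" using at c c' unfolding C1_atlas_def by blast
  then obtain D where D: "((\<phi> \<circ> inv_into V \<psi>) has_derivative D) (at (\<psi> y))"
    unfolding C1_on_def using y yV by blast
  have "\<psi> ` (V \<inter> U) = \<psi> ` V \<inter> inv_into V \<psi> -` U"
    using ch'(4) by (auto simp: inv_into_f_f)
  then have op: "open (\<psi> ` (V \<inter> U))"
    using continuous_open_preimage[OF ch'(5) ch'(2) ch(1)] by simp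
  have "((v \<circ> inv_into U \<phi>) has_derivative (\<lambda>_. 0)) (at ((\<phi> \<circ> inv_into V \<psi>) (\<psi> y)))"
    using d0 ch'(4) yV by simp
  from has_derivative_compose[OF D this]
  have "((\<lambda>z. (v \<circ> inv_into U \<phi>) ((\<phi> \<circ> inv_into V \<psi>) z)) has_derivative (\<lambda>_. 0)) (at (\<psi> y))" .
  then show "((v \<circ> inv_into V \<psi>) has_derivative (\<lambda>_. 0)) (at (\<psi> y))"
    by (rule has_derivative_transform_within_open[OF _ op])
       (use y yV ch(4) ch'(4) in auto)
qed

text \<open>The hypothesis on the critical points enters here only: it makes the distribution of \<open>v\<close> under any
absolutely continuous measure on the manifold absolutely continuous on the line.\<close>

lemma Leb_null_preimage:
  fixes \<A> :: "('m::topological_space, 'e::euclidean_space) chart set"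
  assumes at: "C1_atlas \<A>" and v: "C1_manifold_fun \<A> v"
    and crit: "Leb_null \<A> (critical_points \<A> v)"
    and B: "B \<in> null_sets lborel"
  shows "Leb_null \<A> (v -` B)"
  unfolding Leb_null_def
proof (intro ballI, clarify)
  fix U \<phi> assume c: "(U, \<phi>) \<in> \<A>"
  note ch = atlas_chartD[OF at c]
  obtain f' :: "'e \<Rightarrow> 'e \<Rightarrow>\<^sub>L real" where
    f': "\<And>x. x \<in> \<phi> ` U \<Longrightarrow> ((v \<circ> inv_into U \<phi>) has_derivative blinfun_apply (f' x)) (at x)"
    "continuous_on (\<phi> ` U) f'"
    using v c unfolding C1_manifold_fun_def C1_on_def by blast
  have "negligible {x\<in>\<phi> ` U. f' x \<noteq> 0 \<and> (v \<circ> inv_into U \<phi>) x \<in> B}"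
    by (rule negligible_noncritical_preimage[OF ch(2) f' B])
  moreover have "negligible (\<phi> ` (critical_points \<A> v \<inter> U))"
    using crit c by (auto simp: Leb_null_def negligible_iff_null_sets)
  ultimately have "negligible ({x\<in>\<phi> ` U. f' x \<noteq> 0 \<and> (v \<circ> inv_into U \<phi>) x \<in> B} \<union> \<phi> ` (critical_points \<A> v \<inter> U))"
    by (rule negligible_Un)
  moreover have "\<phi> ` (v -` B \<inter> U) \<subseteq> {x\<in>\<phi> ` U. f' x \<noteq> 0 \<and> (v \<circ> inv_into U \<phi>) x \<in> B} \<union> \<phi> ` (critical_points \<A> v \<inter> U)"
  proof
    fix x assume "x \<in> \<phi> ` (v -` B \<inter> U)"
    then obtain y where y: "v y \<in> B" "y \<in> U" "x = \<phi> y" by auto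
    show "x \<in> {x\<in>\<phi> ` U. f' x \<noteq> 0 \<and> (v \<circ> inv_into U \<phi>) x \<in> B} \<union> \<phi> ` (critical_points \<A> v \<inter> U)"
    proof (cases "f' x = 0")
      case True
      then have "((v \<circ> inv_into U \<phi>) has_derivative (\<lambda>_. 0)) (at (\<phi> y))"
        using f'(1)[of x] y by (simp add: zero_blinfun.rep_eq)
      then have "y \<in> critical_points \<A> v" using critical_in_chart[OF at c y(2)] by blast
      then show ?thesis using y by auto
    next
      case False
      then show ?thesis using y ch(4) by auto
    qed
  qed
  ultimately show "\<phi> ` (v -` B \<inter> U) \<in> null_sets lebesgue"
    unfolding negligible_iff_null_sets[symmetric] by (rule negligible_subset)
qed

section \<open>Birkhoff's theorem for bounded observables\<close>

definition birkhoff_sum :: "('a \<Rightarrow> 'a) \<Rightarrow> ('a \<Rightarrow> real) \<Rightarrow> nat \<Rightarrow> 'a \<Rightarrow> real" where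
  "birkhoff_sum T f n x = (\<Sum>k<n. f ((T ^^ k) x))"

lemma birkhoff_sum_add:
  "birkhoff_sum T f (m + n) x = birkhoff_sum T f m x + birkhoff_sum T f n ((T ^^ m) x)"
proof -
  have "(\<Sum>k<m + n. f ((T ^^ k) x)) = (\<Sum>k<m. f ((T ^^ k) x)) + (\<Sum>k<n. f ((T ^^ (k + m)) x))"
    by (induction n) (auto simp: add.commute)
  then show ?thesis by (simp add: birkhoff_sum_def funpow_add)
qed

lemma measurable_funpow:
  assumes "T \<in> measurable M M"
  shows "(T ^^ k) \<in> measurable M M"
  using assms by (induction k) (auto intro: measurable_comp simp: measurable_ident)

lemma distr_funpow:
  assumes "T \<in> measurable M M" "distr M M T = M"
  shows "distr M M (T ^^ k) = M"
proof (induction k)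
  case 0
  then show ?case by (simp add: id_def)
next
  case (Suc k)
  have "distr M M (T ^^ Suc k) = distr (distr M M (T ^^ k)) M T"
    using assms by (simp add: distr_distr measurable_funpow)
  then show ?case using Suc assms by (simp add: comp_def)
qed

lemma funpow_in_space:
  assumes "T \<in> measurable M M" "x \<in> space M"
  shows "(T ^^ k) x \<in> space M"
  using measurable_space[OF measurable_funpow[OF assms(1)] assms(2)] .

lemma borel_measurable_birkhoff_sum:
  assumes T: "T \<in> measurable M M" and f: "f \<in> borel_measurable M"
  shows "birkhoff_sum T f n \<in> borel_measurable M"
  unfolding birkhoff_sum_def
  by (intro borel_measurable_sum measurable_compose[OF measurable_funpow[OF T] f])

lemma integral_birkhoff_sum:
  assumes T: "T \<in> measurable M M" "distr M M T = M" and f: "integrable M f"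
  shows "integrable M (birkhoff_sum T f n)" "(\<integral>x. birkhoff_sum T f n x \<partial>M) = real n * (\<integral>x. f x \<partial>M)"
proof -
  have fm: "f \<in> borel_measurable M" using f by auto
  have i: "integrable M (\<lambda>x. f ((T ^^ k) x))" for k
    using integrable_distr_eq[OF measurable_funpow[OF T(1)] fm, of k] f distr_funpow[OF T] by simp
  have e: "(\<integral>x. f ((T ^^ k) x) \<partial>M) = (\<integral>x. f x \<partial>M)" for k
    using integral_distr[OF measurable_funpow[OF T(1)] fm, of k] distr_funpow[OF T] by simp
  show "integrable M (birkhoff_sum T f n)" unfolding birkhoff_sum_def using i by auto
  show "(\<integral>x. birkhoff_sum T f n x \<partial>M) = real n * (\<integral>x. f x \<partial>M)"
    unfolding birkhoff_sum_def using i by (simp add: e)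
qed

text \<open>If from every point the averages reach \<open>c\<close> within \<open>N\<close> steps, an orbit of any length \<open>L\<close> can be cut
into blocks on which the average is at least \<open>c\<close>, except for a last piece of length at most \<open>N\<close>.\<close>

lemma birkhoff_sum_stacking:
  assumes stop: "\<And>x. x \<in> A \<Longrightarrow> \<exists>n. 1 \<le> n \<and> n \<le> N \<and> c * real n \<le> birkhoff_sum T f n x"
    and inv: "\<And>x. x \<in> A \<Longrightarrow> T x \<in> A" and f: "\<And>x. 0 \<le> f x" and c: "0 \<le> c" and x: "x \<in> A"
  shows "c * (real L - real N) \<le> birkhoff_sum T f L x"
  using x
proof (induction L arbitrary: x rule: less_induct)
  case (less L)
  show ?case
  proof (cases "L \<le> N")
    case True
    then have "c * (real L - real N) \<le> 0" using c by (simp add: mult_nonneg_nonpos)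
    also have "0 \<le> birkhoff_sum T f L x" unfolding birkhoff_sum_def by (intro sum_nonneg f)
    finally show ?thesis .
  next
    case False
    obtain n where n: "1 \<le> n" "n \<le> N" "c * real n \<le> birkhoff_sum T f n x"
      using stop[OF less.prems] by blast
    have inA: "(T ^^ k) x \<in> A" for k using inv less.prems by (induction k) auto
    have "c * (real (L - n) - real N) \<le> birkhoff_sum T f (L - n) ((T ^^ n) x)"
      using less.IH[OF _ inA[of n], of "L - n"] n False by simp
    moreover have "birkhoff_sum T f L x = birkhoff_sum T f n x + birkhoff_sum T f (L - n) ((T ^^ n) x)"
      using birkhoff_sum_add[of T f n "L - n" x] n False by simp
    moreover have "real (L - n) = real L - real n" using n False by (simp add: of_nat_diff)
    ultimately show ?thesis using n(3) by (simp add: algebra_simps)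
  qed
qed

text \<open>Off a small set \<open>Bad N\<close> the averages reach \<open>c\<close> within \<open>N\<close> steps. Raising \<open>f\<close> by \<open>c\<close> on \<open>Bad N\<close> makes
them reach \<open>c\<close> from everywhere, so that orbits can be cut into blocks as above. Integration over
orbits of growing length gives the bound for the raised function, and the measure of \<open>Bad N\<close> tends
to 0.\<close>

lemma le_integral_if_averages_reach:
  fixes f :: "'a \<Rightarrow> real"
  assumes M: "prob_space M" and T: "T \<in> measurable M M" "distr M M T = M"
    and f: "f \<in> borel_measurable M" "\<And>x. 0 \<le> f x" "\<And>x. f x \<le> 1" and c: "0 \<le> c"
    and ae: "AE x in M. \<exists>n\<ge>1. c * real n \<le> birkhoff_sum T f n x"
  shows "c \<le> (\<integral>x. f x \<partial>M)"
proof -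
  interpret prob_space M by fact
  note [measurable] = T(1) f(1) borel_measurable_birkhoff_sum[OF T(1) f(1)]
  define Bad where "Bad N = {x \<in> space M. \<forall>n. 1 \<le> n \<and> n \<le> N \<longrightarrow> birkhoff_sum T f n x < c * real n}" for N
  have [measurable]: "Bad N \<in> sets M" for N unfolding Bad_def by measurable
  have intf: "integrable M f" using f by (intro integrable_const_bound[where B = 1]) auto
  have bound: "c \<le> (\<integral>x. f x \<partial>M) + c * prob (Bad N)" if N: "1 \<le> N" for N
  proof -
    \<comment> \<open>at a bad point a block of length 1 reaches \<open>c\<close>\<close>
    define f1 where "f1 = (\<lambda>x. f x + c * indicator (Bad N) x)"
    have int1: "integrable M f1" unfolding f1_def using intf
      by (intro Bochner_Integration.integrable_add integrable_mult_right) (auto simp: emeasure_eq_measure)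
    have I1: "(\<integral>x. f1 x \<partial>M) = (\<integral>x. f x \<partial>M) + c * prob (Bad N)"
      unfolding f1_def using intf
      by (subst Bochner_Integration.integral_add) (auto simp: emeasure_eq_measure)
    have f1: "f1 x \<ge> f x" for x using c by (auto simp: f1_def)
    have "\<exists>n. 1 \<le> n \<and> n \<le> N \<and> c * real n \<le> birkhoff_sum T f1 n x" if x: "x \<in> space M" for x
    proof (cases "x \<in> Bad N")
      case True
      then have "c \<le> f1 x" using f(2)[of x] by (simp add: f1_def)
      then show ?thesis using N by (intro exI[of _ 1]) (simp add: birkhoff_sum_def)
    next
      case False
      then obtain n where n: "1 \<le> n" "n \<le> N" "c * real n \<le> birkhoff_sum T f n x"
        using x by (force simp: Bad_def not_less)
      have "birkhoff_sum T f n x \<le> birkhoff_sum T f1 n x"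
        unfolding birkhoff_sum_def by (intro sum_mono f1)
      then show ?thesis using n by force
    qed
    then have stack: "c * (real L - real N) \<le> birkhoff_sum T f1 L x" if "x \<in> space M" for L x
      using that measurable_space[OF T(1)] order_trans[OF f(2) f1] c
      by (intro birkhoff_sum_stacking[where A = "space M"]) auto
    have L: "c * (real L - real N) \<le> real L * (\<integral>x. f1 x \<partial>M)" for L
    proof -
      have "(\<integral>x. c * (real L - real N) \<partial>M) \<le> (\<integral>x. birkhoff_sum T f1 L x \<partial>M)"
        using stack integral_birkhoff_sum(1)[OF T int1] by (intro integral_mono) auto
      then show ?thesis using integral_birkhoff_sum(2)[OF T int1] by (simp add: prob_space)
    qed
    have "c - c * real N * inverse (real (Suc L)) \<le> (\<integral>x. f1 x \<partial>M)" for L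
      using L[of "Suc L"] by (simp add: field_simps)
    moreover have "(\<lambda>L. c - c * real N * inverse (real (Suc L))) \<longlonglongrightarrow> c - c * real N * 0"
      by (intro tendsto_intros LIMSEQ_inverse_real_of_nat)
    ultimately have "c \<le> (\<integral>x. f1 x \<partial>M)"
      by (intro LIMSEQ_le_const2[where X = "\<lambda>L. c - c * real N * inverse (real (Suc L))"]) auto
    then show ?thesis using I1 by simp
  qed
  have "(\<lambda>N. prob (Bad N)) \<longlonglongrightarrow> prob (\<Inter>N. Bad N)"
    by (intro finite_Lim_measure_decseq) (auto simp: decseq_def Bad_def)
  also have "prob (\<Inter>N. Bad N) = 0"
  proof -
    have "AE x in M. x \<notin> (\<Inter>N. Bad N)"
      using ae by eventually_elim (force simp: Bad_def not_less)
    then show ?thesis by (subst prob_eq_0) auto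
  qed
  finally have "(\<lambda>N. (\<integral>x. f x \<partial>M) + c * prob (Bad N)) \<longlonglongrightarrow> (\<integral>x. f x \<partial>M) + c * 0"
    by (intro tendsto_intros)
  then show ?thesis
    by (intro LIMSEQ_le_const[where X = "\<lambda>N. (\<integral>x. f x \<partial>M) + c * prob (Bad N)"]) (auto intro: bound)
qed

text \<open>The sums along the orbits of \<open>x\<close> and of \<open>T x\<close> differ by two terms, which the division by \<open>n\<close> kills.
Since the equality holds at every point, level sets of the limes superior are exactly
invariant, as the definition of ergodicity requires.\<close>

lemma birkhoff_limsup_invariant:
  assumes f: "\<And>x. 0 \<le> f x" "\<And>x. f x \<le> (1::real)"
  shows "limsup (\<lambda>n. ereal (birkhoff_sum T f n (T x) / real n)) = limsup (\<lambda>n. ereal (birkhoff_sum T f n x / real n))"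
proof -
  define d where "d = (\<lambda>n. (f ((T ^^ n) x) - f x) / real n)"
  have "d \<longlonglongrightarrow> 0"
  proof (rule Lim_null_comparison)
    show "\<forall>\<^sub>F n in sequentially. norm (d n) \<le> 1 / real n"
    proof (intro always_eventually allI)
      fix n
      have "\<bar>f ((T ^^ n) x) - f x\<bar> \<le> 1" using f[of "(T ^^ n) x"] f[of x] by linarith
      then show "norm (d n) \<le> 1 / real n" by (simp add: d_def divide_right_mono)
    qed
  qed (rule lim_1_over_n)
  then have "(\<lambda>n. ereal (d n)) \<longlonglongrightarrow> 0" by (simp add: zero_ereal_def)
  then have "limsup (\<lambda>n. ereal (d n) + ereal (birkhoff_sum T f n x / real n))
      = 0 + limsup (\<lambda>n. ereal (birkhoff_sum T f n x / real n))"
    by (intro ereal_limsup_lim_add) auto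
  moreover have "birkhoff_sum T f n (T x) / real n = d n + birkhoff_sum T f n x / real n" for n
    using birkhoff_sum_add[of T f 1 n x] birkhoff_sum_add[of T f n 1 x]
    by (simp add: birkhoff_sum_def d_def add_divide_distrib[symmetric] algebra_simps)
  ultimately show ?thesis by simp
qed

text \<open>The set where the limes superior exceeds \<open>c\<close> is invariant, hence of measure 0 or 1. In the second
case almost every orbit has an average of at least \<open>c\<close>, which forces the integral of \<open>f\<close> to be at
least \<open>c\<close>.\<close>

lemma ergodic_limsup_le:
  fixes f :: "'a \<Rightarrow> real"
  assumes erg: "ergodic_system M T"
    and f: "f \<in> borel_measurable M" "\<And>x. 0 \<le> f x" "\<And>x. f x \<le> 1" and c: "(\<integral>x. f x \<partial>M) < c"
  shows "AE x in M. limsup (\<lambda>n. ereal (birkhoff_sum T f n x / real n)) \<le> ereal c"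
proof -
  have M: "prob_space M" and T: "T \<in> measurable M M" "distr M M T = M"
    and inv: "\<And>B. B \<in> sets M \<Longrightarrow> T -` B \<inter> space M = B \<Longrightarrow> measure M B = 0 \<or> measure M B = 1"
    using erg by (auto simp: ergodic_system_def)
  interpret prob_space M by fact
  note [measurable] = T(1) f(1) borel_measurable_birkhoff_sum[OF T(1) f(1)]
  define D where "D = {x \<in> space M. ereal c < limsup (\<lambda>n. ereal (birkhoff_sum T f n x / real n))}"
  have [measurable]: "D \<in> sets M" unfolding D_def by measurable
  have "T -` D \<inter> space M = D"
    using measurable_space[OF T(1)] by (auto simp: D_def birkhoff_limsup_invariant[of f, OF f(2,3)])
  then have "prob D = 0 \<or> prob D = 1" by (intro inv) auto
  moreover have "prob D \<noteq> 1"
  proof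
    assume "prob D = 1"
    then have "AE x in M. x \<in> D" by (simp add: prob_eq_1)
    then have "AE x in M. \<exists>n\<ge>1. c * real n \<le> birkhoff_sum T f n x"
    proof eventually_elim
      fix x assume x: "x \<in> D"
      show "\<exists>n\<ge>1. c * real n \<le> birkhoff_sum T f n x"
      proof (rule ccontr)
        assume "\<not> ?thesis"
        then have "birkhoff_sum T f n x \<le> c * real n" if "1 \<le> n" for n
          using that by (meson linear)
        then have "\<forall>\<^sub>F n in sequentially. ereal (birkhoff_sum T f n x / real n) \<le> ereal c"
          by (intro eventually_sequentiallyI[of 1]) (simp add: divide_le_eq)
        then have "limsup (\<lambda>n. ereal (birkhoff_sum T f n x / real n)) \<le> ereal c"
          by (rule Limsup_bounded)
        then show False using x by (auto simp: D_def)
      qed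
    qed
    moreover have "0 \<le> (\<integral>x. f x \<partial>M)" using f(2) by simp
    then have "0 \<le> c" using c by simp
    ultimately have "c \<le> (\<integral>x. f x \<partial>M)"
      using le_integral_if_averages_reach[OF M T f] by blast
    then show False using c by simp
  qed
  ultimately have "AE x in M. x \<notin> D" by (subst prob_eq_0[symmetric]) auto
  then show ?thesis using AE_space by eventually_elim (auto simp: D_def not_less)
qed

text \<open>The upper bound on the limes superior for \<open>1 - f\<close> is a lower bound on the limes inferior for \<open>f\<close>.\<close>

lemma birkhoff_ergodic_bounded:
  fixes f :: "'a \<Rightarrow> real"
  assumes erg: "ergodic_system M T"
    and f: "f \<in> borel_measurable M" "\<And>x. 0 \<le> f x" "\<And>x. f x \<le> 1"
  shows "AE x in M. (\<lambda>n. birkhoff_sum T f n x / real n) \<longlonglongrightarrow> (\<integral>x. f x \<partial>M)"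
proof -
  interpret prob_space M using erg by (simp add: ergodic_system_def)
  have intf: "integrable M f" using f by (intro integrable_const_bound[where B = 1]) auto
  have upper: "AE x in M. \<forall>m. \<forall>\<^sub>F n in sequentially. birkhoff_sum T g n x / real n < (\<integral>x. g x \<partial>M) + 2 / real (Suc m)"
    if g: "g \<in> borel_measurable M" "\<And>x. 0 \<le> g x" "\<And>x. g x \<le> 1" for g :: "'a \<Rightarrow> real"
    unfolding AE_all_countable
  proof
    fix m
    have "AE x in M. limsup (\<lambda>n. ereal (birkhoff_sum T g n x / real n)) \<le> ereal ((\<integral>x. g x \<partial>M) + 1 / real (Suc m))"
      by (rule ergodic_limsup_le[OF erg g]) simp
    then show "AE x in M. \<forall>\<^sub>F n in sequentially. birkhoff_sum T g n x / real n < (\<integral>x. g x \<partial>M) + 2 / real (Suc m)"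
    proof eventually_elim
      fix x assume "limsup (\<lambda>n. ereal (birkhoff_sum T g n x / real n)) \<le> ereal ((\<integral>x. g x \<partial>M) + 1 / real (Suc m))"
      also have "\<dots> < ereal ((\<integral>x. g x \<partial>M) + 2 / real (Suc m))" by (simp add: divide_strict_right_mono)
      finally show "\<forall>\<^sub>F n in sequentially. birkhoff_sum T g n x / real n < (\<integral>x. g x \<partial>M) + 2 / real (Suc m)"
        using Limsup_lessD by fastforce
    qed
  qed
  have "AE x in M. \<forall>m. \<forall>\<^sub>F n in sequentially. birkhoff_sum T f n x / real n < (\<integral>x. f x \<partial>M) + 2 / real (Suc m)"
    using upper f by blast
  moreover have "AE x in M. \<forall>m. \<forall>\<^sub>F n in sequentially. birkhoff_sum T (\<lambda>x. 1 - f x) n x / real n < (\<integral>x. (1 - f x) \<partial>M) + 2 / real (Suc m)"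
    using f by (intro upper) auto
  ultimately show ?thesis
  proof eventually_elim
    fix x
    assume 1: "\<forall>m. \<forall>\<^sub>F n in sequentially. birkhoff_sum T f n x / real n < (\<integral>x. f x \<partial>M) + 2 / real (Suc m)"
      and 2: "\<forall>m. \<forall>\<^sub>F n in sequentially. birkhoff_sum T (\<lambda>x. 1 - f x) n x / real n < (\<integral>x. (1 - f x) \<partial>M) + 2 / real (Suc m)"
    have I: "(\<integral>x. (1 - f x) \<partial>M) = 1 - (\<integral>x. f x \<partial>M)"
      using intf by (simp add: prob_space)
    have S: "birkhoff_sum T (\<lambda>x. 1 - f x) n x / real n = 1 - birkhoff_sum T f n x / real n" if "1 \<le> n" for n
      using that by (simp add: birkhoff_sum_def sum_subtractf field_simps)
    show "(\<lambda>n. birkhoff_sum T f n x / real n) \<longlonglongrightarrow> (\<integral>x. f x \<partial>M)"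
    proof (rule tendstoI)
      fix e :: real assume e: "0 < e"
      obtain m where m: "2 / real (Suc m) < e"
        using reals_Archimedean[of "e / 2"] e by (auto simp: field_simps)
      show "\<forall>\<^sub>F n in sequentially. dist (birkhoff_sum T f n x / real n) (\<integral>x. f x \<partial>M) < e"
        using 1[rule_format, of m] 2[rule_format, of m] eventually_ge_at_top[of 1]
      proof eventually_elim
        case (elim n)
        then show ?case using S[of n] I m by (simp add: dist_real_def abs_less_iff)
      qed
    qed
  qed
qed

section \<open>Families of functionals that vanish at infinity\<close>

definition Lp_space :: "nat \<Rightarrow> 'w measure \<Rightarrow> ('w \<Rightarrow> real) set" where
  "Lp_space p M = {f \<in> borel_measurable M. integrable M (\<lambda>x. \<bar>f x\<bar> ^ p)}"

lemma Lp_space_bound: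
  assumes "g \<in> Lp_space p M" "f \<in> borel_measurable M" "\<And>x. x \<in> space M \<Longrightarrow> \<bar>f x\<bar> \<le> \<bar>g x\<bar>"
  shows "f \<in> Lp_space p M"
proof -
  have [measurable]: "f \<in> borel_measurable M" by fact
  have "integrable M (\<lambda>x. \<bar>g x\<bar> ^ p)" using assms(1) by (simp add: Lp_space_def)
  then have "integrable M (\<lambda>x. \<bar>f x\<bar> ^ p)"
  proof (rule Bochner_Integration.integrable_bound)
    show "AE x in M. norm (\<bar>f x\<bar> ^ p) \<le> norm (\<bar>g x\<bar> ^ p)"
      by (rule AE_I2) (simp add: power_mono assms(3))
  qed measurable
  then show ?thesis using assms(2) by (simp add: Lp_space_def)
qed

text \<open>A family of linear functionals on \<open>L\<^sup>p\<close>, bounded uniformly in \<open>t \<ge> 0\<close>. The functions on which the family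
tends to 0 then form a closed subspace. The cases \<open>p = 1\<close> (densities of the speed) and \<open>p = 2\<close>
(Keplerian shear) are both needed.\<close>

locale bounded_functionals =
  fixes M :: "'w measure" and p :: nat and L :: "real \<Rightarrow> ('w \<Rightarrow> real) \<Rightarrow> real" and K :: real
  assumes p: "1 \<le> p"
    and add: "\<And>t f g. 0 \<le> t \<Longrightarrow> f \<in> Lp_space p M \<Longrightarrow> g \<in> Lp_space p M \<Longrightarrow>
      L t (\<lambda>x. f x + g x) = L t f + L t g"
    and scale: "\<And>t f c. 0 \<le> t \<Longrightarrow> f \<in> Lp_space p M \<Longrightarrow> L t (\<lambda>x. c * f x) = c * L t f"
    and bound: "\<And>t f. 0 \<le> t \<Longrightarrow> f \<in> Lp_space p M \<Longrightarrow> \<bar>L t f\<bar> ^ p \<le> K * (\<integral>x. \<bar>f x\<bar> ^ p \<partial>M)"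
begin

definition vanishing :: "('w \<Rightarrow> real) \<Rightarrow> bool" where
  "vanishing f \<longleftrightarrow> ((\<lambda>t. L t f) \<longlongrightarrow> 0) at_top"

lemma vanishing_scale:
  assumes "f \<in> Lp_space p M" "vanishing f"
  shows "vanishing (\<lambda>x. c * f x)"
proof -
  have "((\<lambda>t. c * L t f) \<longlongrightarrow> c * 0) at_top"
    using assms unfolding vanishing_def by (intro tendsto_intros)
  moreover have "\<forall>\<^sub>F t in at_top. c * L t f = L t (\<lambda>x. c * f x)"
    using eventually_ge_at_top[of 0] by eventually_elim (simp add: scale assms)
  ultimately show ?thesis unfolding vanishing_def by (simp add: tendsto_cong)
qed

lemma vanishing_add:
  assumes "f \<in> Lp_space p M" "vanishing f" "g \<in> Lp_space p M" "vanishing g"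
  shows "vanishing (\<lambda>x. f x + g x)"
proof -
  have "((\<lambda>t. L t f + L t g) \<longlongrightarrow> 0 + 0) at_top"
    using assms unfolding vanishing_def by (intro tendsto_intros)
  moreover have "\<forall>\<^sub>F t in at_top. L t f + L t g = L t (\<lambda>x. f x + g x)"
    using eventually_ge_at_top[of 0] by eventually_elim (simp add: add assms)
  ultimately show ?thesis unfolding vanishing_def by (simp add: tendsto_cong)
qed

lemma vanishing_diff:
  assumes "f \<in> Lp_space p M" "vanishing f" "g \<in> Lp_space p M" "vanishing g"
  shows "vanishing (\<lambda>x. f x - g x)"
proof -
  have "(\<lambda>x. -1 * g x) \<in> Lp_space p M" using assms(3) by (auto simp: Lp_space_def)
  with vanishing_add[OF assms(1,2) this vanishing_scale[OF assms(3,4)]] show ?thesis by simp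
qed

text \<open>The bound \<open>\<bar>f - U i\<bar> \<le> \<bar>f\<bar>\<close> lets dominated convergence turn pointwise convergence into convergence in
\<open>L\<^sup>p\<close>. It holds for truncations and for increasing nonnegative approximations.\<close>

lemma vanishing_limit:
  assumes f: "f \<in> Lp_space p M" and U: "\<And>i. U i \<in> Lp_space p M" "\<And>i. vanishing (U i)"
    and dom: "\<And>i x. x \<in> space M \<Longrightarrow> \<bar>f x - U i x\<bar> \<le> \<bar>f x\<bar>"
    and lim: "\<And>x. x \<in> space M \<Longrightarrow> (\<lambda>i. U i x) \<longlonglongrightarrow> f x"
  shows "vanishing f"
  unfolding vanishing_def
proof (rule tendstoI)
  fix e :: real assume e: "0 < e"
  have [measurable]: "f \<in> borel_measurable M" "\<And>i. U i \<in> borel_measurable M"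
    using f U by (auto simp: Lp_space_def)
  have df: "(\<lambda>x. f x - U i x) \<in> Lp_space p M" for i
    by (rule Lp_space_bound[OF f _ dom]) auto
  have "(\<lambda>i. \<integral>x. \<bar>f x - U i x\<bar> ^ p \<partial>M) \<longlonglongrightarrow> (\<integral>x. 0 \<partial>M)"
  proof (rule integral_dominated_convergence)
    show "integrable M (\<lambda>x. \<bar>f x\<bar> ^ p)" using f by (simp add: Lp_space_def)
    show "AE x in M. (\<lambda>i. \<bar>f x - U i x\<bar> ^ p) \<longlonglongrightarrow> 0"
    proof (rule AE_I2)
      fix x assume "x \<in> space M"
      then have "(\<lambda>i. \<bar>f x - U i x\<bar> ^ p) \<longlonglongrightarrow> \<bar>f x - f x\<bar> ^ p" by (intro tendsto_intros lim)
      moreover have "\<bar>f x - f x\<bar> ^ p = 0" using p by (simp add: power_0_left)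
      ultimately show "(\<lambda>i. \<bar>f x - U i x\<bar> ^ p) \<longlonglongrightarrow> 0" by metis
    qed
    show "AE x in M. norm (\<bar>f x - U i x\<bar> ^ p) \<le> \<bar>f x\<bar> ^ p" for i
      by (rule AE_I2) (simp add: power_mono dom)
  qed auto
  then have "(\<lambda>i. K * (\<integral>x. \<bar>f x - U i x\<bar> ^ p \<partial>M)) \<longlonglongrightarrow> K * (\<integral>x. 0 \<partial>M)" by (intro tendsto_intros)
  moreover have "K * (\<integral>x. 0 \<partial>M) < (e / 2) ^ p" using e by simp
  ultimately have "\<forall>\<^sub>F i in sequentially. K * (\<integral>x. \<bar>f x - U i x\<bar> ^ p \<partial>M) < (e / 2) ^ p"
    by (rule order_tendstoD(2))
  then obtain i where i: "K * (\<integral>x. \<bar>f x - U i x\<bar> ^ p \<partial>M) < (e / 2) ^ p"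
    by (auto simp: eventually_sequentially)
  have "\<forall>\<^sub>F t in at_top. dist (L t (U i)) 0 < e / 2"
    using U(2)[of i] e unfolding vanishing_def by (intro tendstoD) auto
  then show "\<forall>\<^sub>F t in at_top. dist (L t f) 0 < e"
    using eventually_ge_at_top[of 0]
  proof eventually_elim
    case (elim t)
    have "\<bar>L t (\<lambda>x. f x - U i x)\<bar> ^ p < (e / 2) ^ p"
      using bound[OF elim(2) df, of i] i by linarith
    then have "\<bar>L t (\<lambda>x. f x - U i x)\<bar> < e / 2" by (rule power_less_imp_less_base) (use e in auto)
    moreover have "L t f = L t (\<lambda>x. f x - U i x) + L t (U i)"
      using add[OF elim(2) df U(1), of i i] by simp
    ultimately show ?case using elim(1) by simp
  qed
qed

text \<open>The sets whose indicator vanishes form a Dynkin system, and the measurable functions in \<open>L\<^sup>p\<close> are then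
reached by linear combinations and monotone limits.\<close>

lemma vanishing_from_generator:
  assumes fin: "finite_measure M"
    and G: "Int_stable G" "G \<subseteq> Pow (space M)" "sets M = sigma_sets (space M) G"
    and basic: "\<And>A. A \<in> G \<Longrightarrow> vanishing (indicator A)"
    and one: "vanishing (\<lambda>_. 1)"
    and f: "f \<in> Lp_space p M"
  shows "vanishing f"
proof -
  interpret finite_measure M by fact
  have oneLp: "(\<lambda>_. 1) \<in> Lp_space p M" by (simp add: Lp_space_def)
  have indLp: "indicator A \<in> Lp_space p M" if "A \<in> sets M" for A
    by (rule Lp_space_bound[OF oneLp]) (use that in \<open>auto simp: indicator_def\<close>)
  have zero: "vanishing (\<lambda>_. 0)" using vanishing_scale[OF oneLp one, of 0] by simp
  have sets: "vanishing (indicator A)" if A: "A \<in> sets M" for A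
  proof -
    have "A \<in> sigma_sets (space M) G" using A G(3) by simp
    from G(1,2) this show ?thesis
    proof (induction rule: sigma_sets_induct_disjoint)
      case (basic A)
      then show ?case by (rule assms(5))
    next
      case empty
      show ?case using zero by simp
    next
      case (compl A)
      then have A: "A \<in> sets M" by (simp add: G(3))
      have "vanishing (\<lambda>x. 1 - indicator A x)"
        by (rule vanishing_diff[OF oneLp one indLp[OF A] compl(2)])
      moreover have "(\<lambda>x. 1 - indicator A x) \<in> Lp_space p M"
        by (rule Lp_space_bound[OF oneLp]) (use A in \<open>auto simp: indicator_def\<close>)
      ultimately show ?case
      proof -
        assume U: "vanishing (\<lambda>x. 1 - indicator A x)" "(\<lambda>x. 1 - indicator A x) \<in> Lp_space p M"
        show "vanishing (indicator (space M - A))"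
        proof (rule vanishing_limit[where U = "\<lambda>_ x. 1 - indicator A x"])
        show "indicator (space M - A) \<in> Lp_space p M" using A by (intro indLp) auto
          show "(\<lambda>i. 1 - indicator A x) \<longlonglongrightarrow> (indicator (space M - A) x :: real)" if "x \<in> space M" for x
            using that by (simp add: indicator_def)
        qed (use U in \<open>auto simp: indicator_def\<close>)
      qed
    next
      case (union A)
      then have A: "A i \<in> sets M" for i by (auto simp: G(3))
      have part: "vanishing (indicator (\<Union>i<n. A i))" for n
      proof (induction n)
        case 0
        show ?case using zero by simp
      next
        case (Suc n)
        have "(\<Union>i<n. A i) \<inter> A n = {}"
        proof -
          have "A i \<inter> A n = {}" if "i < n" for i
            using union(1) that unfolding disjoint_family_on_def by (metis UNIV_I less_irrefl)
          then show ?thesis by blast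
        qed
        then have "(indicator (\<Union>i<Suc n. A i) :: _ \<Rightarrow> real) = (\<lambda>x. indicator (\<Union>i<n. A i) x + indicator (A n) x)"
          by (auto simp: fun_eq_iff lessThan_Suc indicator_def)
        then show ?case using Suc union(3)[of n] A
          by (simp only:) (intro vanishing_add indLp; auto)
      qed
      show ?case
      proof (rule vanishing_limit[where U = "\<lambda>n. indicator (\<Union>i<n. A i)"])
        show "\<bar>indicator (\<Union>i. A i) x - indicator (\<Union>i<n. A i) x\<bar> \<le> \<bar>indicator (\<Union>i. A i) x :: real\<bar>" for n x
          by (auto simp: indicator_def)
      qed (use A part in \<open>auto intro: indLp LIMSEQ_indicator_UN\<close>)
    qed
  qed
  have nonneg: "g \<in> Lp_space p M \<longrightarrow> vanishing g" if "g \<in> borel_measurable M" "\<And>x. 0 \<le> g x" for g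
    using that
  proof (induction rule: borel_measurable_induct_real)
    case (set A)
    then show ?case using sets by simp
  next
    case (mult u c)
    show ?case
    proof
      assume cu: "(\<lambda>x. c * u x) \<in> Lp_space p M"
      show "vanishing (\<lambda>x. c * u x)"
      proof (cases "c = 0")
        case True
        then show ?thesis using zero True by simp
      next
        case False
        have "u \<in> Lp_space p M" using cu False mult(2)
          by (auto simp: Lp_space_def abs_mult power_mult_distrib)
        then show ?thesis using mult by (auto intro: vanishing_scale)
      qed
    qed
  next
    case (add u w)
    show ?case
    proof
      assume s: "(\<lambda>x. w x + u x) \<in> Lp_space p M"
      have "u \<in> Lp_space p M" "w \<in> Lp_space p M"
        by (rule Lp_space_bound[OF s]; use add in force)+
      then show "vanishing (\<lambda>x. w x + u x)" using add by (auto intro: vanishing_add)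
    qed
  next
    case (seq U)
    show ?case
    proof
      assume g: "g \<in> Lp_space p M"
      have le: "U i x \<le> g x" if "x \<in> space M" for i x
        using seq.hyps(3) seq.hyps(4)[OF that] by (intro incseq_le) (auto simp: incseq_def le_fun_def)
      show "vanishing g"
      proof (rule vanishing_limit[OF g, where U = U])
        show Ui: "U i \<in> Lp_space p M" for i
        proof (rule Lp_space_bound[OF g])
          show "\<bar>U i x\<bar> \<le> \<bar>g x\<bar>" if "x \<in> space M" for x
            using le[OF that, of i] seq.hyps(2)[of i x] by linarith
        qed (rule seq.hyps(1))
        show "vanishing (U i)" for i using seq.IH Ui by simp
        show "\<bar>g x - U i x\<bar> \<le> \<bar>g x\<bar>" if "x \<in> space M" for i x
          using le[OF that, of i] seq.hyps(2)[of i x] by linarith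
      qed (use seq.hyps(4) in auto)
    qed
  qed
  have [measurable]: "f \<in> borel_measurable M" using f by (simp add: Lp_space_def)
  have "(\<lambda>x. max (f x) 0) \<in> Lp_space p M" "(\<lambda>x. max (- f x) 0) \<in> Lp_space p M"
    by (rule Lp_space_bound[OF f]; force)+
  then have "vanishing (\<lambda>x. max (f x) 0 - max (- f x) 0)"
    using nonneg by (intro vanishing_diff) auto
  moreover have "(\<lambda>x. max (f x) 0 - max (- f x) 0) = f" by (auto simp: fun_eq_iff)
  ultimately show ?thesis by simp
qed

end

section \<open>Functions with a mean, seen at a random speed\<close>

text \<open>Half-open intervals make consecutive integrals add up without overlap.\<close>

definition has_mean :: "(real \<Rightarrow> real) \<Rightarrow> real \<Rightarrow> bool" where
  "has_mean q c \<longleftrightarrow> ((\<lambda>R. (\<integral>u. indicator {0<..R} u * q u \<partial>lborel) / R) \<longlongrightarrow> c) at_top"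

lemma integrable_lborel_indicator_bounded:
  fixes q :: "real \<Rightarrow> real"
  assumes [measurable]: "q \<in> borel_measurable borel" and q: "\<And>u. \<bar>q u\<bar> \<le> 1"
  shows "integrable lborel (\<lambda>u. indicator {a<..b} u * q u)"
proof -
  have "integrable lborel (indicator {a<..b} :: real \<Rightarrow> real)"
    by (cases "a \<le> b") (auto intro: integrable_real_indicator)
  then show ?thesis
    by (rule Bochner_Integration.integrable_bound) (auto simp: indicator_def q)
qed

text \<open>Substituting \<open>u = s + w * t\<close> yields \<open>1 / t\<close> times the integral of \<open>q\<close> over \<open>{s<..s + b * t}\<close>, an interval
of length proportional to \<open>t\<close> with fixed left end.\<close>

lemma has_mean_interval:
  fixes q :: "real \<Rightarrow> real"
  assumes [measurable]: "q \<in> borel_measurable borel" and q: "\<And>u. \<bar>q u\<bar> \<le> 1"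
    and c: "has_mean q c" and s: "0 \<le> s" and b: "0 < b"
  shows "((\<lambda>t. \<integral>w. indicator {0<..b} w * q (s + w * t) \<partial>lborel) \<longlongrightarrow> b * c) at_top"
proof -
  define Q where "Q R = (\<integral>u. indicator {0<..R} u * q u \<partial>lborel)" for R
  have int: "integrable lborel (\<lambda>u. indicator {a<..b} u * q u)" for a b
    by (rule integrable_lborel_indicator_bounded) (auto simp: q)
  have conv: "(\<integral>w. indicator {0<..b} w * q (s + w * t) \<partial>lborel) = (Q (s + b * t) - Q s) / t" if t: "0 < t" for t
  proof -
    have "Q (s + b * t) - Q s = (\<integral>u. indicator {s<..s + b * t} u * q u \<partial>lborel)"
    proof -
      have "b * t > 0" using b t by simp
      have "Q (s + b * t) - Q s = (\<integral>u. indicator {0<..s + b * t} u * q u - indicator {0<..s} u * q u \<partial>lborel)"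
        unfolding Q_def by (rule Bochner_Integration.integral_diff[symmetric]) (rule int)+
      also have "\<dots> = (\<integral>u. indicator {s<..s + b * t} u * q u \<partial>lborel)"
        by (rule Bochner_Integration.integral_cong) (use s \<open>b * t > 0\<close> in \<open>auto simp: indicator_def\<close>)
      finally show ?thesis .
    qed
    also have "\<dots> = \<bar>t\<bar> *\<^sub>R (\<integral>w. indicator {s<..s + b * t} (s + t * w) * q (s + t * w) \<partial>lborel)"
      by (rule lborel_integral_real_affine) (use t in auto)
    also have "(\<integral>w. indicator {s<..s + b * t} (s + t * w) * q (s + t * w) \<partial>lborel)
        = (\<integral>w. indicator {0<..b} w * q (s + w * t) \<partial>lborel)"
      by (rule Bochner_Integration.integral_cong)
         (use t in \<open>auto simp: indicator_def mult.commute zero_less_mult_iff\<close>)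
    finally show ?thesis using t by (simp add: field_simps)
  qed
  have top: "filterlim (\<lambda>t. s + b * t) at_top at_top"
    by (intro filterlim_tendsto_add_at_top[OF tendsto_const] filterlim_tendsto_pos_mult_at_top[OF tendsto_const b] filterlim_ident)
  have "((\<lambda>R. Q R / R) \<longlongrightarrow> c) at_top" using c unfolding has_mean_def Q_def .
  from filterlim_compose[OF this top]
  have 1: "((\<lambda>t. Q (s + b * t) / (s + b * t)) \<longlongrightarrow> c) at_top" .
  have inv: "((\<lambda>t::real. inverse t) \<longlongrightarrow> 0) at_top" by (rule tendsto_inverse_0_at_top) (rule filterlim_ident)
  have "((\<lambda>t. Q (s + b * t) / (s + b * t) * (s * inverse t + b) - Q s * inverse t) \<longlongrightarrow> c * (s * 0 + b) - Q s * 0) at_top"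
    by (intro tendsto_intros 1 inv)
  moreover have "\<forall>\<^sub>F t in at_top. Q (s + b * t) / (s + b * t) * (s * inverse t + b) - Q s * inverse t
      = (\<integral>w. indicator {0<..b} w * q (s + w * t) \<partial>lborel)"
    using eventually_gt_at_top[of 0]
  proof eventually_elim
    case (elim t)
    have "0 < s + b * t" using s b elim by (simp add: add_nonneg_pos)
    moreover have "s * inverse t + b = (s + b * t) / t" using elim by (simp add: field_simps)
    ultimately have eq: "Q (s + b * t) / (s + b * t) * (s * inverse t + b) = Q (s + b * t) / t" by simp
    show ?case unfolding eq conv[OF elim] diff_divide_distrib by (simp add: divide_inverse)
  qed
  ultimately show ?thesis by (simp add: tendsto_cong mult.commute)
qed

lemma bounded_functionals_integral:
  assumes q: "\<And>t. q t \<in> borel_measurable M" "\<And>t x. \<bar>q t x\<bar> \<le> K"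
  shows "bounded_functionals M 1 (\<lambda>t f. \<integral>x. f x * q t x \<partial>M) K"
proof -
  note [measurable] = q(1)
  have int: "integrable M (\<lambda>x. f x * q t x)" if "f \<in> Lp_space 1 M" for f t
  proof -
    have f[measurable]: "f \<in> borel_measurable M" and "integrable M (\<lambda>x. \<bar>f x\<bar>)" using that by (auto simp: Lp_space_def)
    then have "integrable M (\<lambda>x. K * \<bar>f x\<bar>)" by auto
    then show ?thesis
    proof (rule Bochner_Integration.integrable_bound)
      show "AE x in M. norm (f x * q t x) \<le> norm (K * \<bar>f x\<bar>)"
      proof (rule AE_I2)
        fix x
        have "\<bar>q t x\<bar> \<le> \<bar>K\<bar>" using q(2)[of t x] by linarith
        then have "\<bar>f x\<bar> * \<bar>q t x\<bar> \<le> \<bar>f x\<bar> * \<bar>K\<bar>" by (intro mult_left_mono) auto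
        then show "norm (f x * q t x) \<le> norm (K * \<bar>f x\<bar>)" by (simp add: abs_mult mult.commute)
      qed
    qed measurable
  qed
  show ?thesis
  proof
    fix t :: real and f g assume f: "f \<in> Lp_space 1 M" and g: "g \<in> Lp_space 1 M"
    show "(\<integral>x. (f x + g x) * q t x \<partial>M) = (\<integral>x. f x * q t x \<partial>M) + (\<integral>x. g x * q t x \<partial>M)"
      using int[OF f] int[OF g] by (simp add: distrib_right)
  next
    fix t :: real and f and c :: real
    show "(\<integral>x. c * f x * q t x \<partial>M) = c * (\<integral>x. f x * q t x \<partial>M)"
      by (simp add: mult.assoc)
  next
    fix t :: real and f assume f: "f \<in> Lp_space 1 M"
    have "\<bar>\<integral>x. f x * q t x \<partial>M\<bar> \<le> (\<integral>x. \<bar>f x * q t x\<bar> \<partial>M)" by (rule integral_abs_bound)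
    also have "\<dots> \<le> (\<integral>x. K * \<bar>f x\<bar> \<partial>M)"
    proof (rule integral_mono)
      show "integrable M (\<lambda>x. K * \<bar>f x\<bar>)" using f by (auto simp: Lp_space_def)
      show "\<bar>f x * q t x\<bar> \<le> K * \<bar>f x\<bar>" for x
        using mult_left_mono[OF q(2)[of t x] abs_ge_zero[of "f x"]] by (simp add: abs_mult mult.commute)
    qed (use int[OF f] in auto)
    finally show "\<bar>\<integral>x. f x * q t x \<partial>M\<bar> ^ 1 \<le> K * (\<integral>x. \<bar>f x\<bar> ^ 1 \<partial>M)" by simp
  qed simp
qed

text \<open>For densities on a bounded interval the half-lines serve as generator, with \<open>has_mean_interval\<close>
giving the limit on them; all other densities are reached by truncation. The density has to vanish on the negative half-line, where nothing is known about \<open>q\<close>.\<close>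

lemma has_mean_integrable:
  fixes q :: "real \<Rightarrow> real"
  assumes q[measurable]: "q \<in> borel_measurable borel" and q1: "\<And>u. \<bar>q u\<bar> \<le> 1"
    and c: "has_mean q c" and s: "0 \<le> s" and \<kappa>: "integrable lborel \<kappa>"
    and pos: "\<And>w. w \<le> 0 \<Longrightarrow> \<kappa> w = 0"
  shows "((\<lambda>t. \<integral>w. \<kappa> w * (q (s + w * t) - c) \<partial>lborel) \<longlongrightarrow> 0) at_top"
proof -
  have qc: "\<bar>q u - c\<bar> \<le> 1 + \<bar>c\<bar>" for u using q1[of u] by linarith
  \<comment> \<open>Lebesgue measure on \<open>{0<..N}\<close>, but with all Borel sets of the line, so that the half-lines \<open>{..a}\<close> generate\<close>
  define M where "M N = density lborel (\<lambda>w. ennreal (indicator {0<..real N} w))" for N :: nat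
  define L where "L = (\<lambda>t f. \<integral>w. f w * (q (s + w * t) - c) \<partial>lborel)"
  define LN where "LN N = (\<lambda>t f. \<integral>w. f w * (q (s + w * t) - c) \<partial>M N)" for N
  have intM: "(\<integral>w. f w \<partial>M N) = (\<integral>w. indicator {0<..real N} w * f w \<partial>lborel)"
    if "f \<in> borel_measurable borel" for f :: "real \<Rightarrow> real" and N
    unfolding M_def using that by (subst integral_density) auto
  have sM[simp]: "sets (M N) = sets borel" "space (M N) = UNIV" for N by (auto simp: M_def)
  interpret L: bounded_functionals lborel 1 L "1 + \<bar>c\<bar>"
    unfolding L_def by (rule bounded_functionals_integral) (auto simp: qc)
  have trunc: "L.vanishing (\<lambda>w. indicator {0<..real N} w * \<kappa> w)" for N
  proof -
    interpret LN: bounded_functionals "M N" 1 "LN N" "1 + \<bar>c\<bar>"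
      unfolding LN_def by (rule bounded_functionals_integral) (auto simp: qc M_def)
    have interval: "LN.vanishing (indicator {..a})" for a
    proof -
      define b where "b = min a (real N)"
      have *: "LN N t (indicator {..a}) = (\<integral>w. indicator {0<..b} w * (q (s + w * t) - c) \<partial>lborel)" for t
        unfolding LN_def by (subst intM) (auto intro!: Bochner_Integration.integral_cong simp: b_def indicator_def)
      show ?thesis
      proof (cases "0 < b")
        case True
        have ib: "integrable lborel (indicator {0<..b} :: real \<Rightarrow> real)"
          using True by (intro integrable_real_indicator) auto
        have "((\<lambda>t. (\<integral>w. indicator {0<..b} w * q (s + w * t) \<partial>lborel) - b * c) \<longlongrightarrow> b * c - b * c) at_top"
          by (intro tendsto_intros has_mean_interval q q1 c s True)
        moreover have "LN N t (indicator {..a}) = (\<integral>w. indicator {0<..b} w * q (s + w * t) \<partial>lborel) - b * c" for t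
        proof -
          have "LN N t (indicator {..a}) = (\<integral>w. indicator {0<..b} w * q (s + w * t) - indicator {0<..b} w * c \<partial>lborel)"
            unfolding * by (simp add: right_diff_distrib)
          also have "\<dots> = (\<integral>w. indicator {0<..b} w * q (s + w * t) \<partial>lborel) - (\<integral>w. indicator {0<..b} w * c \<partial>lborel)"
            by (rule Bochner_Integration.integral_diff)
               (use ib in \<open>auto intro!: integrable_lborel_indicator_bounded q1\<close>)
          also have "(\<integral>w. indicator {0<..b} w * c \<partial>lborel) = b * c"
            using True by simp
          finally show ?thesis .
        qed
        ultimately show ?thesis unfolding LN.vanishing_def by simp
      next
        case False
        then have "LN N t (indicator {..a}) = 0" for t unfolding * by simp
        then show ?thesis unfolding LN.vanishing_def by simp
      qed
    qed
    have "LN.vanishing \<kappa>"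
    proof (rule LN.vanishing_from_generator[where G = "range (\<lambda>a. {..a::real})"])
      show "finite_measure (M N)"
        by (rule finite_measureI) (auto simp: M_def emeasure_density ennreal_indicator)
      show "Int_stable (range (\<lambda>a. {..a::real}))" by (auto simp: Int_stable_def)
      show "sets (M N) = sigma_sets (space (M N)) (range (\<lambda>a. {..a::real}))"
        unfolding sM by (subst borel_eq_atMost) simp
      show "LN.vanishing (\<lambda>_. 1)"
      proof -
        have "LN N t (\<lambda>_. 1) = LN N t (indicator {..real N})" for t
          unfolding LN_def by (subst (1 2) intM) (auto intro!: Bochner_Integration.integral_cong simp: indicator_def)
        then show ?thesis using interval[of "real N"] by (simp add: LN.vanishing_def)
      qed
      show "\<kappa> \<in> Lp_space 1 (M N)"
      proof -
        have "integrable lborel (\<lambda>w. indicator {0<..real N} w *\<^sub>R \<bar>\<kappa> w\<bar>)"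
          using \<kappa> by (intro integrable_mult_indicator) auto
        then have "integrable (M N) (\<lambda>w. \<bar>\<kappa> w\<bar>)"
          using \<kappa> unfolding M_def by (subst integrable_density) auto
        then show ?thesis using \<kappa> by (auto simp: Lp_space_def M_def)
      qed
    qed (use interval in auto)
    moreover have "LN N t \<kappa> = L t (\<lambda>w. indicator {0<..real N} w * \<kappa> w)" for t
      unfolding LN_def L_def using \<kappa> by (subst intM) (auto simp: mult.assoc)
    ultimately show ?thesis by (simp add: L.vanishing_def LN.vanishing_def)
  qed
  have "L.vanishing \<kappa>"
  proof (rule L.vanishing_limit[where U = "\<lambda>N w. indicator {0<..real N} w * \<kappa> w"])
    show \<kappa>L: "\<kappa> \<in> Lp_space 1 lborel" using \<kappa> by (auto simp: Lp_space_def)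
    show "(\<lambda>w. indicator {0<..real N} w * \<kappa> w) \<in> Lp_space 1 lborel" for N
      by (rule Lp_space_bound[OF \<kappa>L]) (use \<kappa> in \<open>auto simp: indicator_def\<close>)
    show "(\<lambda>N. indicator {0<..real N} w * \<kappa> w) \<longlonglongrightarrow> \<kappa> w" for w
    proof (rule tendsto_eventually, rule eventually_sequentiallyI)
      fix N assume "nat \<lceil>w\<rceil> \<le> N"
      then have "w \<le> real N" by linarith
      then show "indicator {0<..real N} w * \<kappa> w = \<kappa> w" using pos[of w] by (auto simp: indicator_def)
    qed
    show "\<bar>\<kappa> w - indicator {0<..real N} w * \<kappa> w\<bar> \<le> \<bar>\<kappa> w\<bar>" for N w
      by (auto simp: indicator_def)
  qed (rule trunc)
  then have "((\<lambda>t. L t \<kappa>) \<longlongrightarrow> 0) at_top" unfolding L.vanishing_def .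
  then show ?thesis unfolding L_def .
qed

text \<open>For \<open>k \<ge> 0\<close> the image under \<open>v\<close> of the measure with density \<open>k\<close> has a Lebesgue density by the theorem
of Radon and Nikodym, to which the previous lemma applies. A general \<open>k\<close> is split into its positive and
negative parts.\<close>

lemma has_mean_speed:
  fixes q :: "real \<Rightarrow> real" and v k :: "'m \<Rightarrow> real"
  assumes q[measurable]: "q \<in> borel_measurable borel" and q1: "\<And>u. \<bar>q u\<bar> \<le> 1"
    and c: "has_mean q c" and s: "0 \<le> s"
    and v[measurable]: "v \<in> borel_measurable \<rho>" and vpos: "\<And>y. 0 < v y"
    and ac: "\<And>B. B \<in> null_sets lborel \<Longrightarrow> v -` B \<inter> space \<rho> \<in> null_sets \<rho>"
    and k: "integrable \<rho> k"
  shows "((\<lambda>t. \<integral>y. k y * q (s + v y * t) \<partial>\<rho>) \<longlongrightarrow> c * (\<integral>y. k y \<partial>\<rho>)) at_top"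
proof -
  have bd: "integrable \<rho> (\<lambda>y. k y * q (s + v y * t))" if "integrable \<rho> k" for k t
  proof (rule Bochner_Integration.integrable_bound[OF that])
    show "AE y in \<rho>. norm (k y * q (s + v y * t)) \<le> norm (k y)"
      using q1 by (auto simp: abs_mult mult_left_le)
  qed (use that in measurable)
  have nonneg: "((\<lambda>t. \<integral>y. k y * q (s + v y * t) \<partial>\<rho>) \<longlongrightarrow> c * (\<integral>y. k y \<partial>\<rho>)) at_top"
    if k: "integrable \<rho> k" "\<And>y. 0 \<le> k y" for k
  proof -
    have [measurable]: "k \<in> borel_measurable \<rho>" using k by auto
    define m where "m = distr (density \<rho> (\<lambda>y. ennreal (k y))) borel v"
    have [simp]: "sets m = sets borel" "space m = UNIV" by (auto simp: m_def)
    have im: "(\<integral>w. g w \<partial>m) = (\<integral>y. k y * g (v y) \<partial>\<rho>)" if [measurable]: "g \<in> borel_measurable borel" for g :: "real \<Rightarrow> real"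
      unfolding m_def using k by (simp add: integral_distr integral_density)
    have ekm: "emeasure m B = (\<integral>\<^sup>+y. ennreal (k y) * indicator (v -` B \<inter> space \<rho>) y \<partial>\<rho>)"
      if B[measurable]: "B \<in> sets borel" for B
      unfolding m_def using measurable_sets[OF v B] by (simp add: emeasure_distr emeasure_density)
    have fin: "finite_measure m"
    proof (rule finite_measureI)
      have "emeasure m UNIV \<le> (\<integral>\<^sup>+y. ennreal (k y) \<partial>\<rho>)"
        by (subst ekm) (auto intro!: nn_integral_mono simp: indicator_def)
      also have "\<dots> < \<infinity>" using k integrableD(2)[OF k(1)] by (simp add: nn_integral_eq_integral)
      finally show "emeasure m (space m) \<noteq> \<infinity>" by simp
    qed
    interpret m: finite_measure m by fact
    have "absolutely_continuous lborel m"
      unfolding absolutely_continuous_def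
    proof
      fix B :: "real set" assume B: "B \<in> null_sets lborel"
      then have [measurable]: "B \<in> sets borel" by auto
      have "AE y in \<rho>. y \<notin> v -` B \<inter> space \<rho>" using ac[OF B] AE_not_in by blast
      then have "emeasure m B = 0"
        by (subst ekm, simp, subst nn_integral_0_iff_AE) (auto elim: eventually_mono simp: indicator_def)
      then show "B \<in> null_sets m" by (auto simp: null_sets_def)
    qed
    then obtain D where D: "D \<in> borel_measurable lborel" "AE x in lborel. RN_deriv lborel m x = ennreal (D x)"
      "\<And>x. 0 \<le> D x"
      using sigma_finite_measure.real_RN_deriv[OF sigma_finite_lborel fin] by auto
    have [measurable]: "D \<in> borel_measurable borel" using D(1) by simp
    have "m = density lborel (RN_deriv lborel m)"
      using sigma_finite_measure.density_RN_deriv[OF sigma_finite_lborel \<open>absolutely_continuous lborel m\<close>] by simp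
    also have "\<dots> = density lborel (\<lambda>x. ennreal (D x))"
      by (rule density_cong) (use D(2) in auto)
    finally have mD: "m = density lborel (\<lambda>x. ennreal (D x))" .
    have "(\<integral>\<^sup>+x. ennreal (D x) \<partial>lborel) = emeasure m UNIV"
      unfolding mD by (subst emeasure_density) auto
    moreover have "emeasure m UNIV < \<infinity>"
      using m.emeasure_finite[of UNIV] by (metis infinity_ennreal_def top.not_eq_extremum)
    ultimately have "integrable lborel D"
      using D(3) by (intro integrableI_nonneg) auto
    then have intD: "integrable lborel (\<lambda>w. indicator {0<..} w * D w)"
      using integrable_real_mult_indicator[of "{0<..}" lborel D] by (simp add: mult.commute)
    have eq: "(\<integral>w. (indicator {0<..} w * D w) * (q (s + w * t) - c) \<partial>lborel)
        = (\<integral>y. k y * q (s + v y * t) \<partial>\<rho>) - c * (\<integral>y. k y \<partial>\<rho>)" for t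
    proof -
      have "(\<integral>w. (indicator {0<..} w * D w) * (q (s + w * t) - c) \<partial>lborel)
         = (\<integral>w. indicator {0<..} w * (q (s + w * t) - c) \<partial>m)"
        unfolding mD using D(3) by (subst integral_density) (auto simp: ac_simps)
      also have "\<dots> = (\<integral>y. k y * (indicator {0<..} (v y) * (q (s + v y * t) - c)) \<partial>\<rho>)"
        by (rule im) measurable
      also have "\<dots> = (\<integral>y. k y * q (s + v y * t) - c * k y \<partial>\<rho>)"
        by (rule Bochner_Integration.integral_cong) (auto simp: vpos algebra_simps)
      also have "\<dots> = (\<integral>y. k y * q (s + v y * t) \<partial>\<rho>) - c * (\<integral>y. k y \<partial>\<rho>)"
        using bd[OF k(1)] k(1) by simp
      finally show ?thesis .
    qed
    have "((\<lambda>t. (\<integral>y. k y * q (s + v y * t) \<partial>\<rho>) - c * (\<integral>y. k y \<partial>\<rho>)) \<longlongrightarrow> 0) at_top"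
      using has_mean_integrable[OF q q1 c s intD] unfolding eq by simp
    then show ?thesis by (simp add: LIM_zero_iff)
  qed
  have p: "integrable \<rho> (\<lambda>y. max (k y) 0)" and n: "integrable \<rho> (\<lambda>y. max (- k y) 0)" using k by auto
  have "((\<lambda>t. (\<integral>y. max (k y) 0 * q (s + v y * t) \<partial>\<rho>) - (\<integral>y. max (- k y) 0 * q (s + v y * t) \<partial>\<rho>))
      \<longlongrightarrow> c * (\<integral>y. max (k y) 0 \<partial>\<rho>) - c * (\<integral>y. max (- k y) 0 \<partial>\<rho>)) at_top"
    by (intro tendsto_diff nonneg p n) auto
  moreover have "(\<integral>y. max (k y) 0 * q (s + v y * t) \<partial>\<rho>) - (\<integral>y. max (- k y) 0 * q (s + v y * t) \<partial>\<rho>)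
      = (\<integral>y. k y * q (s + v y * t) \<partial>\<rho>)" for t
    unfolding Bochner_Integration.integral_diff[OF bd[OF p] bd[OF n], symmetric]
    by (rule Bochner_Integration.integral_cong) (auto simp: max_def)
  moreover have "(\<integral>y. max (k y) 0 \<partial>\<rho>) - (\<integral>y. max (- k y) 0 \<partial>\<rho>) = (\<integral>y. k y \<partial>\<rho>)"
    unfolding Bochner_Integration.integral_diff[OF p n, symmetric]
    by (rule Bochner_Integration.integral_cong) (auto simp: max_def)
  ultimately show ?thesis by (simp add: right_diff_distrib[symmetric])
qed

text \<open>Between \<open>\<lfloor>R\<rfloor>\<close> and \<open>R\<close> the integral of a function bounded by 1 changes by at most 1.\<close>

lemma has_mean_discrete:
  fixes q :: "real \<Rightarrow> real"
  assumes q[measurable]: "q \<in> borel_measurable borel" and q1: "\<And>u. \<bar>q u\<bar> \<le> 1"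
    and lim: "(\<lambda>n. (\<integral>u. indicator {0<..real n} u * q u \<partial>lborel) / real n) \<longlonglongrightarrow> c"
  shows "has_mean q c"
proof -
  define Q where "Q R = (\<integral>u. indicator {0<..R} u * q u \<partial>lborel)" for R
  have int: "integrable lborel (\<lambda>u. indicator {a<..b} u * q u)" for a b
    by (rule integrable_lborel_indicator_bounded) (auto simp: q1)
  have fl: "filterlim (\<lambda>R::real. nat \<lfloor>R\<rfloor>) sequentially at_top"
    unfolding filterlim_at_top
  proof
    fix n
    show "\<forall>\<^sub>F R::real in at_top. n \<le> nat \<lfloor>R\<rfloor>"
      using eventually_ge_at_top[of "real n"] by eventually_elim (simp add: le_nat_floor)
  qed
  have diff: "\<bar>Q R - Q (real (nat \<lfloor>R\<rfloor>))\<bar> \<le> 1" if R: "1 \<le> R" for R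
  proof -
    define n where "n = nat \<lfloor>R\<rfloor>"
    have n: "real n \<le> R" "R \<le> real n + 1" using R by (auto simp: n_def)
    have "Q R - Q (real n) = (\<integral>u. indicator {0<..R} u * q u - indicator {0<..real n} u * q u \<partial>lborel)"
      unfolding Q_def by (rule Bochner_Integration.integral_diff[symmetric]) (rule int)+
    also have "\<dots> = (\<integral>u. indicator {real n<..R} u * q u \<partial>lborel)"
      by (rule Bochner_Integration.integral_cong) (use n(1) in \<open>auto simp: indicator_def\<close>)
    finally have "\<bar>Q R - Q (real n)\<bar> \<le> (\<integral>u. \<bar>indicator {real n<..R} u * q u\<bar> \<partial>lborel)"
      by (simp only: integral_abs_bound)
    also have "\<dots> \<le> (\<integral>u. indicator {real n<..R} u \<partial>lborel)"
    proof (rule integral_mono)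
      show "integrable lborel (indicator {real n<..R} :: real \<Rightarrow> real)"
        using n by (intro integrable_real_indicator) auto
    qed (use int q1 in \<open>auto simp: indicator_def\<close>)
    also have "\<dots> \<le> 1" using n by simp
    finally show ?thesis by (simp add: n_def)
  qed
  have "((\<lambda>R. (Q R - Q (real (nat \<lfloor>R\<rfloor>))) / R) \<longlongrightarrow> 0) at_top"
  proof (rule Lim_null_comparison)
    show "\<forall>\<^sub>F R in at_top. norm ((Q R - Q (real (nat \<lfloor>R\<rfloor>))) / R) \<le> inverse R"
      using eventually_ge_at_top[of 1]
    proof eventually_elim
      case (elim R)
      then have "\<bar>Q R - Q (real (nat \<lfloor>R\<rfloor>))\<bar> / R \<le> 1 / R"
        using diff by (intro divide_right_mono) auto
      then show ?case using elim by (simp add: divide_inverse abs_mult)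
    qed
    show "((\<lambda>R::real. inverse R) \<longlongrightarrow> 0) at_top" by (rule tendsto_inverse_0_at_top) (rule filterlim_ident)
  qed
  moreover have "((\<lambda>R::real. Q (real (nat \<lfloor>R\<rfloor>)) / real (nat \<lfloor>R\<rfloor>)) \<longlongrightarrow> c) at_top"
    using filterlim_compose[OF lim fl] unfolding Q_def .
  moreover have "((\<lambda>R. real (nat \<lfloor>R\<rfloor>) / R) \<longlongrightarrow> 1) at_top"
  proof (rule tendsto_sandwich)
    show "\<forall>\<^sub>F R in at_top. 1 - inverse R \<le> real (nat \<lfloor>R\<rfloor>) / R"
      using eventually_ge_at_top[of 1]
    proof eventually_elim
      case (elim R)
      then have "R - 1 \<le> real (nat \<lfloor>R\<rfloor>)" by linarith
      then have "(R - 1) / R \<le> real (nat \<lfloor>R\<rfloor>) / R" using elim by (intro divide_right_mono) auto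
      moreover have "(R - 1) / R = 1 - inverse R" using elim by (simp add: field_simps)
      ultimately show ?case by (simp only:)
    qed
    show "\<forall>\<^sub>F R::real in at_top. real (nat \<lfloor>R\<rfloor>) / R \<le> 1"
      using eventually_ge_at_top[of 1] by eventually_elim auto
    have "((\<lambda>R::real. 1 - inverse R) \<longlongrightarrow> 1 - 0) at_top"
      by (intro tendsto_intros tendsto_inverse_0_at_top filterlim_ident)
    then show "((\<lambda>R::real. 1 - inverse R) \<longlongrightarrow> 1) at_top" by simp
  qed auto
  ultimately have "((\<lambda>R. (Q R - Q (real (nat \<lfloor>R\<rfloor>))) / R + Q (real (nat \<lfloor>R\<rfloor>)) / real (nat \<lfloor>R\<rfloor>) * (real (nat \<lfloor>R\<rfloor>) / R)) \<longlongrightarrow> 0 + c * 1) at_top"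
    by (intro tendsto_intros)
  moreover have "\<forall>\<^sub>F R in at_top. (Q R - Q (real (nat \<lfloor>R\<rfloor>))) / R + Q (real (nat \<lfloor>R\<rfloor>)) / real (nat \<lfloor>R\<rfloor>) * (real (nat \<lfloor>R\<rfloor>) / R) = Q R / R"
    using eventually_ge_at_top[of 1]
  proof eventually_elim
    case (elim R)
    have "Q 0 = 0" by (simp add: Q_def)
    then show ?case using elim by (simp add: diff_divide_distrib)
  qed
  ultimately show ?thesis unfolding has_mean_def Q_def[symmetric] by (simp add: tendsto_cong)
qed

section \<open>The suspension and the fibred flow\<close>

abbreviation circle :: "real measure" where
  "circle \<equiv> restrict_space lborel {0..<1}"

lemma prob_space_circle: "prob_space circle"
  by (rule prob_spaceI) (simp add: emeasure_restrict_space space_restrict_space)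

lemma measurable_id_circle: "(\<lambda>s. s) \<in> measurable circle borel"
  by (rule measurable_restrict_space1) simp

text \<open>With \<open>b = frac a\<close>, the rotation moves \<open>{0..<1 - b}\<close> onto \<open>{b..<1}\<close> and \<open>{1 - b..<1}\<close> onto \<open>{0..<b}\<close>, both by
translations.\<close>

lemma nn_integral_circle_rotation:
  fixes f :: "real \<Rightarrow> ennreal"
  assumes f: "f \<in> borel_measurable circle"
  shows "(\<integral>\<^sup>+s. f (frac (s + a)) \<partial>circle) = (\<integral>\<^sup>+s. f s \<partial>circle)"
proof -
  define g where "g = (\<lambda>s. f s * indicator {0..<1} s)"
  have g[measurable]: "g \<in> borel_measurable borel"
    using f unfolding g_def by (subst (asm) borel_measurable_restrict_space_iff_ennreal) auto
  define b where "b = frac a"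
  have b: "0 \<le> b" "b < 1" by (auto simp: b_def frac_lt_1)
  have fr: "frac (s + a) = (if s < 1 - b then s + b else s + b - 1)" if "0 \<le> s" "s < 1" for s
  proof -
    have "frac (s + a) = (if frac s + b < 1 then frac s + b else frac s + b - 1)"
      unfolding b_def by (rule frac_add)
    also have "frac s = s" using that by (simp add: frac_eq)
    finally show ?thesis by auto
  qed
  have "(\<integral>\<^sup>+s. f (frac (s + a)) \<partial>circle) = (\<integral>\<^sup>+s. f (frac (s + a)) * indicator {0..<1} s \<partial>lborel)"
    by (subst nn_integral_restrict_space) auto
  also have "\<dots> = (\<integral>\<^sup>+s. g (b + 1 * s) * indicator {b..<1} (b + 1 * s) + g (b - 1 + 1 * s) * indicator {0..<b} (b - 1 + 1 * s) \<partial>lborel)"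
    by (rule nn_integral_cong) (use b in \<open>auto simp: fr g_def indicator_def add_ac add_diff_eq\<close>)
  also have "\<dots> = (\<integral>\<^sup>+s. g (b + 1 * s) * indicator {b..<1} (b + 1 * s) \<partial>lborel) + (\<integral>\<^sup>+s. g (b - 1 + 1 * s) * indicator {0..<b} (b - 1 + 1 * s) \<partial>lborel)"
    by (rule nn_integral_add) measurable
  also have "(\<integral>\<^sup>+s. g (b + 1 * s) * indicator {b..<1} (b + 1 * s) \<partial>lborel) = (\<integral>\<^sup>+s. g s * indicator {b..<1} s \<partial>lborel)"
    by (subst nn_integral_real_affine[where c = 1 and t = b]) auto
  also have "(\<integral>\<^sup>+s. g (b - 1 + 1 * s) * indicator {0..<b} (b - 1 + 1 * s) \<partial>lborel) = (\<integral>\<^sup>+s. g s * indicator {0..<b} s \<partial>lborel)"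
    by (subst nn_integral_real_affine[where c = 1 and t = "b - 1"]) auto
  also have "(\<integral>\<^sup>+s. g s * indicator {b..<1} s \<partial>lborel) + (\<integral>\<^sup>+s. g s * indicator {0..<b} s \<partial>lborel)
      = (\<integral>\<^sup>+s. g s * indicator {b..<1} s + g s * indicator {0..<b} s \<partial>lborel)"
    by (rule nn_integral_add[symmetric]) measurable
  also have "\<dots> = (\<integral>\<^sup>+s. f s * indicator {0..<1} s \<partial>lborel)"
    by (rule nn_integral_cong) (use b in \<open>auto simp: g_def indicator_def\<close>)
  also have "\<dots> = (\<integral>\<^sup>+s. f s \<partial>circle)"
    by (subst nn_integral_restrict_space) auto
  finally show ?thesis .
qed

lemma suspension_flow_frac:
  "suspension_flow T w t (x, s) = ((T ^^ nat \<lfloor>s + w * t\<rfloor>) x, frac (s + w * t))"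
  by (simp add: suspension_flow_def frac_def)

text \<open>Both the base point and the height are allowed to vary, and the latter may depend on a third variable
through the speed; the measurability of all flows below is a special case.\<close>

lemma measurable_suspension:
  assumes T: "T \<in> measurable \<nu> \<nu>" and [measurable]: "x \<in> measurable N \<nu>" "u \<in> borel_measurable N"
  shows "(\<lambda>z. ((T ^^ nat \<lfloor>u z\<rfloor>) (x z), frac (u z))) \<in> measurable N (suspension_measure \<nu>)"
  unfolding suspension_measure_def
proof (rule measurable_Pair)
  show "(\<lambda>z. (T ^^ nat \<lfloor>u z\<rfloor>) (x z)) \<in> measurable N \<nu>"
  proof (rule measurable_compose_countable[where f = "\<lambda>k z. (T ^^ k) (x z)" and g = "\<lambda>z. nat \<lfloor>u z\<rfloor>"])
    show "(\<lambda>z. (T ^^ k) (x z)) \<in> measurable N \<nu>" for k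
      by (rule measurable_compose[OF _ measurable_funpow[OF T]]) measurable
  qed measurable
  have "(\<lambda>z. frac (u z)) \<in> borel_measurable N" unfolding frac_def by measurable
  then show "(\<lambda>z. frac (u z)) \<in> measurable N circle"
    by (intro measurable_restrict_space2) (auto simp: frac_lt_1)
qed

lemma measurable_fibred_flow:
  assumes T: "T \<in> measurable \<nu> \<nu>" and v: "v \<in> borel_measurable \<rho>"
  shows "fibred_flow T v t \<in> measurable (suspension_measure \<nu> \<Otimes>\<^sub>M \<rho>) (suspension_measure \<nu> \<Otimes>\<^sub>M \<rho>)"
proof -
  have eq: "fibred_flow T v t = (\<lambda>z. (((T ^^ nat \<lfloor>snd (fst z) + v (snd z) * t\<rfloor>) (fst (fst z)),
      frac (snd (fst z) + v (snd z) * t)), snd z))"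
    by (auto simp: fibred_flow_def suspension_flow_def frac_def split: prod.splits)
  note [measurable] = v
  have s: "snd \<in> borel_measurable (suspension_measure \<nu>)"
    unfolding suspension_measure_def by (rule measurable_compose[OF measurable_snd measurable_id_circle])
  have x: "fst \<in> measurable (suspension_measure \<nu>) \<nu>" unfolding suspension_measure_def by measurable
  show ?thesis unfolding eq
    by (intro measurable_Pair measurable_suspension[OF T])
       (auto intro!: measurable_compose[OF measurable_fst x] borel_measurable_add borel_measurable_times
          measurable_compose[OF measurable_fst s] measurable_compose[OF measurable_snd v])
qed

lemma prob_space_suspension:
  assumes "prob_space \<nu>"
  shows "prob_space (suspension_measure \<nu>)"
proof -
  interpret \<nu>: prob_space \<nu> by fact
  interpret c: prob_space circle by (rule prob_space_circle)
  interpret pair_prob_space \<nu> circle ..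
  show ?thesis unfolding suspension_measure_def by (rule P.prob_space_axioms)
qed

text \<open>For a fixed height \<open>s\<close> the flow applies a power of \<open>T\<close>, which preserves \<open>\<nu>\<close>; what remains is a rotation
in \<open>s\<close>.\<close>

lemma nn_integral_suspension_flow:
  fixes f :: "'a \<times> real \<Rightarrow> ennreal"
  assumes \<nu>: "prob_space \<nu>" and T: "T \<in> measurable \<nu> \<nu>" "distr \<nu> \<nu> T = \<nu>"
    and f: "f \<in> borel_measurable (suspension_measure \<nu>)"
  shows "(\<integral>\<^sup>+z. f (suspension_flow T w t z) \<partial>suspension_measure \<nu>) = (\<integral>\<^sup>+z. f z \<partial>suspension_measure \<nu>)"
proof -
  interpret \<nu>: prob_space \<nu> by fact
  interpret c: prob_space circle by (rule prob_space_circle)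
  interpret pair_sigma_finite \<nu> circle ..
  have f'[measurable]: "f \<in> borel_measurable (\<nu> \<Otimes>\<^sub>M circle)" using f by (simp add: suspension_measure_def)
  have fl: "suspension_flow T w t \<in> measurable (suspension_measure \<nu>) (suspension_measure \<nu>)"
  proof -
    have "(\<lambda>z. ((T ^^ nat \<lfloor>snd z + w * t\<rfloor>) (fst z), frac (snd z + w * t))) \<in> measurable (suspension_measure \<nu>) (suspension_measure \<nu>)"
      by (rule measurable_suspension[OF T(1)])
         (auto simp: suspension_measure_def intro!: borel_measurable_add measurable_compose[OF measurable_snd measurable_id_circle])
    then show ?thesis by (simp add: suspension_flow_frac[abs_def] case_prod_beta' suspension_flow_def frac_def)
  qed
  have "(\<lambda>z. f (suspension_flow T w t z)) \<in> borel_measurable (\<nu> \<Otimes>\<^sub>M circle)"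
    using measurable_compose[OF fl f] by (simp add: suspension_measure_def)
  then have "(\<integral>\<^sup>+z. f (suspension_flow T w t z) \<partial>(\<nu> \<Otimes>\<^sub>M circle))
      = (\<integral>\<^sup>+s. \<integral>\<^sup>+x. f (suspension_flow T w t (x, s)) \<partial>\<nu> \<partial>circle)"
    by (rule nn_integral_snd[symmetric])
  also have "\<dots> = (\<integral>\<^sup>+s. \<integral>\<^sup>+x. f (x, frac (s + w * t)) \<partial>\<nu> \<partial>circle)"
  proof (rule nn_integral_cong)
    fix s
    have fs: "frac (s + w * t) \<in> space circle" by (auto simp: space_restrict_space frac_lt_1)
    have "(\<integral>\<^sup>+x. f (suspension_flow T w t (x, s)) \<partial>\<nu>)
        = (\<integral>\<^sup>+x. f (x, frac (s + w * t)) \<partial>distr \<nu> \<nu> (T ^^ nat \<lfloor>s + w * t\<rfloor>))"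
      using fs by (subst nn_integral_distr[OF measurable_funpow[OF T(1)]]) (auto simp: suspension_flow_frac)
    then show "(\<integral>\<^sup>+x. f (suspension_flow T w t (x, s)) \<partial>\<nu>) = (\<integral>\<^sup>+x. f (x, frac (s + w * t)) \<partial>\<nu>)"
      by (simp add: distr_funpow[OF T])
  qed
  also have "\<dots> = (\<integral>\<^sup>+s. \<integral>\<^sup>+x. f (x, s) \<partial>\<nu> \<partial>circle)"
    by (rule nn_integral_circle_rotation[where f = "\<lambda>s. \<integral>\<^sup>+x. f (x, s) \<partial>\<nu>"]) measurable
  also have "\<dots> = (\<integral>\<^sup>+z. f z \<partial>(\<nu> \<Otimes>\<^sub>M circle))"
    by (rule nn_integral_snd) measurable
  finally show ?thesis by (simp add: suspension_measure_def)
qed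

lemma distr_fibred_flow:
  assumes \<nu>: "prob_space \<nu>" and T: "T \<in> measurable \<nu> \<nu>" "distr \<nu> \<nu> T = \<nu>"
    and \<rho>: "prob_space \<rho>" and v: "v \<in> borel_measurable \<rho>"
  shows "distr (suspension_measure \<nu> \<Otimes>\<^sub>M \<rho>) (suspension_measure \<nu> \<Otimes>\<^sub>M \<rho>) (fibred_flow T v t)
    = suspension_measure \<nu> \<Otimes>\<^sub>M \<rho>"
proof (rule measure_eqI)
  interpret s: prob_space "suspension_measure \<nu>" using \<nu> by (rule prob_space_suspension)
  interpret \<rho>: prob_space \<rho> by fact
  interpret pair_sigma_finite "suspension_measure \<nu>" \<rho> ..
  note fl[measurable] = measurable_fibred_flow[OF T(1) v, of t]
  fix E assume "E \<in> sets (distr (suspension_measure \<nu> \<Otimes>\<^sub>M \<rho>) (suspension_measure \<nu> \<Otimes>\<^sub>M \<rho>) (fibred_flow T v t))"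
  then have E[measurable]: "E \<in> sets (suspension_measure \<nu> \<Otimes>\<^sub>M \<rho>)" by simp
  let ?\<mu> = "suspension_measure \<nu> \<Otimes>\<^sub>M \<rho>"
  have "emeasure (distr ?\<mu> ?\<mu> (fibred_flow T v t)) E = (\<integral>\<^sup>+z. indicator E z \<partial>distr ?\<mu> ?\<mu> (fibred_flow T v t))"
    by simp
  also have "\<dots> = (\<integral>\<^sup>+z. indicator E (fibred_flow T v t z) \<partial>?\<mu>)"
    by (rule nn_integral_distr) auto
  also have "\<dots> = (\<integral>\<^sup>+y. \<integral>\<^sup>+x. indicator E (fibred_flow T v t (x, y)) \<partial>suspension_measure \<nu> \<partial>\<rho>)"
    by (rule nn_integral_snd[symmetric]) measurable
  also have "\<dots> = (\<integral>\<^sup>+y. \<integral>\<^sup>+x. indicator E (x, y) \<partial>suspension_measure \<nu> \<partial>\<rho>)"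
  proof (rule nn_integral_cong)
    fix y assume y: "y \<in> space \<rho>"
    have "(\<lambda>x. indicator E (x, y) :: ennreal) \<in> borel_measurable (suspension_measure \<nu>)" using y by measurable
    from nn_integral_suspension_flow[OF \<nu> T this, of "v y" t]
    show "(\<integral>\<^sup>+x. indicator E (fibred_flow T v t (x, y)) \<partial>suspension_measure \<nu>) = (\<integral>\<^sup>+x. indicator E (x, y) \<partial>suspension_measure \<nu>)"
      by (simp add: fibred_flow_def)
  qed
  also have "\<dots> = (\<integral>\<^sup>+z. indicator E z \<partial>?\<mu>)" by (rule nn_integral_snd) measurable
  also have "\<dots> = emeasure ?\<mu> E" by simp
  finally show "emeasure (distr ?\<mu> ?\<mu> (fibred_flow T v t)) E = emeasure ?\<mu> E" .
qed simp

lemma suspension_flow_add: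
  assumes w: "0 \<le> w" "0 \<le> s" "0 \<le> t" and r: "0 \<le> r"
  shows "suspension_flow T w (s + t) (x, r) = suspension_flow T w s (suspension_flow T w t (x, r))"
proof -
  define u where "u = r + w * t"
  have u: "0 \<le> u" using w r by (simp add: u_def)
  have "r + w * (s + t) = of_int \<lfloor>u\<rfloor> + (frac u + w * s)"
    by (simp add: u_def frac_def algebra_simps)
  then have fl: "\<lfloor>r + w * (s + t)\<rfloor> = \<lfloor>u\<rfloor> + \<lfloor>frac u + w * s\<rfloor>" by simp
  then have fr: "frac (r + w * (s + t)) = frac (frac u + w * s)"
    by (simp add: frac_def u_def algebra_simps)
  have "0 \<le> \<lfloor>frac u + w * s\<rfloor>" using w by simp
  then have "nat \<lfloor>r + w * (s + t)\<rfloor> = nat \<lfloor>frac u + w * s\<rfloor> + nat \<lfloor>u\<rfloor>" using fl u by (simp add: nat_add_distrib)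
  then show ?thesis
    unfolding suspension_flow_frac u_def[symmetric] fr by (simp add: funpow_add)
qed

lemma pmp_semiflow_fibred:
  assumes \<nu>: "prob_space \<nu>" and T: "T \<in> measurable \<nu> \<nu>" "distr \<nu> \<nu> T = \<nu>"
    and \<rho>: "prob_space \<rho>" and v: "v \<in> borel_measurable \<rho>" "\<And>y. 0 < v y"
  shows "pmp_semiflow (suspension_measure \<nu> \<Otimes>\<^sub>M \<rho>) (fibred_flow T v)"
proof -
  interpret s: prob_space "suspension_measure \<nu>" using \<nu> by (rule prob_space_suspension)
  interpret \<rho>: prob_space \<rho> by fact
  interpret pair_prob_space "suspension_measure \<nu>" \<rho> ..
  have sp: "0 \<le> r \<and> r < 1" if "((x, r), y) \<in> space (suspension_measure \<nu> \<Otimes>\<^sub>M \<rho>)" for x r y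
    using that by (auto simp: space_pair_measure suspension_measure_def space_restrict_space)
  have zero: "fibred_flow T v 0 z = z" if "z \<in> space (suspension_measure \<nu> \<Otimes>\<^sub>M \<rho>)" for z
  proof -
    obtain x r y where z: "z = ((x, r), y)" by (metis prod.collapse)
    have "\<lfloor>r\<rfloor> = 0" using sp that z by (simp add: floor_eq_iff)
    then show ?thesis by (simp add: z fibred_flow_def suspension_flow_def)
  qed
  have add: "fibred_flow T v (s + t) z = fibred_flow T v s (fibred_flow T v t z)"
    if "0 \<le> s" "0 \<le> t" "z \<in> space (suspension_measure \<nu> \<Otimes>\<^sub>M \<rho>)" for s t z
  proof -
    obtain x r y where z: "z = ((x, r), y)" by (metis prod.collapse)
    have "suspension_flow T (v y) (s + t) (x, r) = suspension_flow T (v y) s (suspension_flow T (v y) t (x, r))"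
      using that sp v(2)[of y] z by (intro suspension_flow_add) (auto intro: less_imp_le)
    then show ?thesis by (simp add: z fibred_flow_def)
  qed
  show ?thesis
    unfolding pmp_semiflow_def
    using P.prob_space_axioms measurable_fibred_flow[OF T(1) v(1)] distr_fibred_flow[OF \<nu> T \<rho> v(1)] zero add
    by blast
qed

text \<open>Whether the orbit of \<open>(x, 0)\<close> with unit speed is in \<open>E\<close> at time \<open>u\<close>. The orbit of \<open>(x, s)\<close> with speed \<open>w\<close>
reads the same function at time \<open>s + w * t\<close>, so that one function per base point serves all heights
and all speeds.\<close>

definition suspension_orbit :: "('a \<Rightarrow> 'a) \<Rightarrow> ('a \<times> real) set \<Rightarrow> 'a \<Rightarrow> real \<Rightarrow> real" where
  "suspension_orbit T E x u = indicator E ((T ^^ nat \<lfloor>u\<rfloor>) x, frac u)"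

lemma borel_measurable_suspension_orbit:
  assumes T: "T \<in> measurable \<nu> \<nu>" and E: "E \<in> sets (suspension_measure \<nu>)" and x: "x \<in> space \<nu>"
  shows "suspension_orbit T E x \<in> borel_measurable borel"
proof -
  have "(\<lambda>u. ((T ^^ nat \<lfloor>u\<rfloor>) x, frac u)) \<in> measurable borel (suspension_measure \<nu>)"
    by (rule measurable_suspension[OF T]) (use x in auto)
  from measurable_compose[OF this borel_measurable_indicator[OF E]]
  show ?thesis by (simp add: suspension_orbit_def[abs_def])
qed

text \<open>During the time interval from \<open>n\<close> to \<open>n + 1\<close> the orbit runs once through the fibre over \<open>(T ^^ n) x\<close>.\<close>

lemma integral_suspension_orbit:
  assumes T: "T \<in> measurable \<nu> \<nu>" and E: "E \<in> sets (suspension_measure \<nu>)" and x: "x \<in> space \<nu>"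
  shows "(\<integral>u. indicator {0<..real n} u * suspension_orbit T E x u \<partial>lborel)
    = birkhoff_sum T (\<lambda>x. \<integral>s. indicator E (x, s) \<partial>circle) n x"
proof (induction n)
  case 0
  then show ?case by (simp add: birkhoff_sum_def)
next
  case (Suc n)
  let ?q = "suspension_orbit T E x"
  have qm[measurable]: "?q \<in> borel_measurable borel" by (rule borel_measurable_suspension_orbit[OF T E x])
  have q1: "\<bar>?q u\<bar> \<le> 1" for u by (simp add: suspension_orbit_def indicator_def)
  have "(\<integral>u. indicator {0<..real (Suc n)} u * ?q u \<partial>lborel)
      = (\<integral>u. indicator {0<..real n} u * ?q u + indicator {real n<..real (Suc n)} u * ?q u \<partial>lborel)"
    by (rule Bochner_Integration.integral_cong) (auto simp: indicator_def)
  also have "\<dots> = (\<integral>u. indicator {0<..real n} u * ?q u \<partial>lborel) + (\<integral>u. indicator {real n<..real (Suc n)} u * ?q u \<partial>lborel)"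
    by (intro Bochner_Integration.integral_add integrable_lborel_indicator_bounded qm q1)
  also have "(\<integral>u. indicator {real n<..real (Suc n)} u * ?q u \<partial>lborel)
      = (\<integral>s. indicator {real n<..real (Suc n)} (real n + 1 * s) * ?q (real n + 1 * s) \<partial>lborel)"
    using lborel_integral_real_affine[of 1 "\<lambda>u. indicator {real n<..real (Suc n)} u * ?q u" "real n"] by simp
  also have "\<dots> = (\<integral>s. indicator {0..<1} s *\<^sub>R indicator E ((T ^^ n) x, s) \<partial>lborel)"
  proof (rule integral_cong_AE)
    have mE: "(\<lambda>s. indicator E ((T ^^ n) x, s) :: real) \<in> borel_measurable circle"
      using measurable_compose[OF measurable_Pair1'[OF funpow_in_space[OF T x, of n]]
          borel_measurable_indicator[OF E[unfolded suspension_measure_def]]] .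
    then show "(\<lambda>s. indicator {0..<1} s *\<^sub>R indicator E ((T ^^ n) x, s) :: real) \<in> borel_measurable lborel"
      by (subst (asm) borel_measurable_restrict_space_iff) auto
    \<comment> \<open>the half-open intervals on both sides disagree at their end points\<close>
    have "AE s in lborel. s \<notin> {0, 1::real}"
      by (rule AE_not_in, rule finite_imp_null_set_lborel) simp
    then show "AE s in lborel. indicator {real n<..real (Suc n)} (real n + 1 * s) * ?q (real n + 1 * s)
        = indicator {0..<1} s *\<^sub>R indicator E ((T ^^ n) x, s)"
    proof eventually_elim
      case (elim s)
      show ?case
      proof (cases "0 \<le> s \<and> s < 1")
        case True
        then have "\<lfloor>real n + s\<rfloor> = int n" "frac (real n + s) = s"
          by (auto simp: floor_eq_iff frac_def)
        then show ?thesis using True elim by (simp add: suspension_orbit_def indicator_def)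
      next
        case False
        then show ?thesis using elim by (auto simp: indicator_def)
      qed
    qed
  qed measurable
  also have "\<dots> = (\<integral>s. indicator E ((T ^^ n) x, s) \<partial>circle)"
    by (rule integral_restrict_space[symmetric]) simp
  finally show ?case using Suc by (simp add: birkhoff_sum_def)
qed

lemma suspension_orbit_has_mean:
  assumes erg: "ergodic_system \<nu> T" and E: "E \<in> sets (suspension_measure \<nu>)"
  shows "AE x in \<nu>. has_mean (suspension_orbit T E x) (measure (suspension_measure \<nu>) E)"
proof -
  have \<nu>: "prob_space \<nu>" and T: "T \<in> measurable \<nu> \<nu>" using erg by (auto simp: ergodic_system_def)
  interpret \<nu>: prob_space \<nu> by fact
  interpret c: prob_space circle by (rule prob_space_circle)
  interpret pair_prob_space \<nu> circle ..
  define G where "G = (\<lambda>x. \<integral>s. indicator E (x, s) \<partial>circle :: real)"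
  have E'[measurable]: "E \<in> sets (\<nu> \<Otimes>\<^sub>M circle)" using E by (simp add: suspension_measure_def)
  have Gm: "G \<in> borel_measurable \<nu>" unfolding G_def
    by (rule c.borel_measurable_lebesgue_integral) simp
  have G0: "0 \<le> G x" for x unfolding G_def by simp
  have G1: "G x \<le> 1" for x
  proof (cases "integrable circle (\<lambda>s. indicator E (x, s) :: real)")
    case True
    then have "G x \<le> (\<integral>s. 1 \<partial>circle)" unfolding G_def by (intro integral_mono) (auto simp: indicator_def)
    then show ?thesis using c.prob_space by simp
  next
    case False
    then show ?thesis unfolding G_def by (simp add: not_integrable_integral_eq)
  qed
  have IG: "(\<integral>x. G x \<partial>\<nu>) = measure (suspension_measure \<nu>) E"
  proof -
    have "integrable (\<nu> \<Otimes>\<^sub>M circle) (indicator E :: _ \<Rightarrow> real)"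
      by (rule integrable_real_indicator) (auto simp: P.emeasure_eq_measure)
    from integral_fst'[OF this] show ?thesis
      unfolding G_def by (simp add: suspension_measure_def)
  qed
  have "AE x in \<nu>. (\<lambda>n. birkhoff_sum T G n x / real n) \<longlonglongrightarrow> (\<integral>x. G x \<partial>\<nu>)"
    by (rule birkhoff_ergodic_bounded[OF erg Gm G0 G1])
  then show ?thesis using AE_space
  proof eventually_elim
    case (elim x)
    show ?case
      using elim(1) integral_suspension_orbit[OF T E elim(2)] unfolding IG
      by (intro has_mean_discrete borel_measurable_suspension_orbit[OF T E elim(2)])
         (auto simp: suspension_orbit_def indicator_def G_def)
  qed
qed

section \<open>Keplerian shear tested on a generator\<close>

lemma square_integrable_Lp: "square_integrable M f \<longleftrightarrow> f \<in> Lp_space 2 M"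
  by (simp add: square_integrable_def Lp_space_def)

lemma integral_Cauchy_Schwarz:
  assumes f: "square_integrable M f" and g: "square_integrable M g"
  shows "integrable M (\<lambda>x. f x * g x)"
    and "(\<integral>x. f x * g x \<partial>M)\<^sup>2 \<le> (\<integral>x. (f x)\<^sup>2 \<partial>M) * (\<integral>x. (g x)\<^sup>2 \<partial>M)"
proof -
  have [measurable]: "f \<in> borel_measurable M" "g \<in> borel_measurable M"
    and i2: "integrable M (\<lambda>x. (f x)\<^sup>2)" "integrable M (\<lambda>x. (g x)\<^sup>2)"
    using f g by (auto simp: square_integrable_def)
  show i: "integrable M (\<lambda>x. f x * g x)"
  proof (rule Bochner_Integration.integrable_bound[OF Bochner_Integration.integrable_add[OF i2]])
    show "AE x in M. norm (f x * g x) \<le> norm ((f x)\<^sup>2 + (g x)\<^sup>2)"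
    proof (rule AE_I2)
      fix x
      have "2 * (\<bar>f x\<bar> * \<bar>g x\<bar>) \<le> (f x)\<^sup>2 + (g x)\<^sup>2"
        using sum_squares_bound[of "\<bar>f x\<bar>" "\<bar>g x\<bar>"] by simp
      moreover have "0 \<le> \<bar>f x\<bar> * \<bar>g x\<bar>" by simp
      ultimately show "norm (f x * g x) \<le> norm ((f x)\<^sup>2 + (g x)\<^sup>2)"
        by (simp only: real_norm_def abs_mult)
    qed
  qed measurable
  have "(\<integral>\<^sup>+x. ennreal \<bar>f x\<bar> * ennreal \<bar>g x\<bar> \<partial>M) = (\<integral>\<^sup>+x. ennreal \<bar>f x * g x\<bar> \<partial>M)"
    by (simp add: ennreal_mult abs_mult)
  also have "\<dots> = ennreal (\<integral>x. \<bar>f x * g x\<bar> \<partial>M)"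
    using nn_integral_eq_integral[OF integrable_abs[OF i]] by simp
  finally have "ennreal ((\<integral>x. \<bar>f x * g x\<bar> \<partial>M)\<^sup>2) = (\<integral>\<^sup>+x. ennreal \<bar>f x\<bar> * ennreal \<bar>g x\<bar> \<partial>M)\<^sup>2"
    by (simp add: ennreal_power)
  also have "\<dots> \<le> (\<integral>\<^sup>+x. ennreal \<bar>f x\<bar> ^ 2 \<partial>M) * (\<integral>\<^sup>+x. ennreal \<bar>g x\<bar> ^ 2 \<partial>M)"
    by (rule Cauchy_Schwarz_nn_integral) auto
  also have "\<dots> = ennreal ((\<integral>x. (f x)\<^sup>2 \<partial>M) * (\<integral>x. (g x)\<^sup>2 \<partial>M))"
    using i2 by (simp add: ennreal_power nn_integral_eq_integral ennreal_mult)
  finally have "(\<integral>x. \<bar>f x * g x\<bar> \<partial>M)\<^sup>2 \<le> (\<integral>x. (f x)\<^sup>2 \<partial>M) * (\<integral>x. (g x)\<^sup>2 \<partial>M)"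
    by (subst (asm) ennreal_le_iff) auto
  moreover have "(\<integral>x. f x * g x \<partial>M)\<^sup>2 \<le> (\<integral>x. \<bar>f x * g x\<bar> \<partial>M)\<^sup>2"
    using integral_abs_bound[of M "\<lambda>x. f x * g x"] by (subst abs_le_square_iff[symmetric]) auto
  ultimately show "(\<integral>x. f x * g x \<partial>M)\<^sup>2 \<le> (\<integral>x. (f x)\<^sup>2 \<partial>M) * (\<integral>x. (g x)\<^sup>2 \<partial>M)" by linarith
qed

text \<open>The sets that are invariant up to null sets already form a \<open>\<sigma>\<close>-algebra, so the one generated by them
contains no others.\<close>

lemma invariant_algebra:
  fixes \<mu> :: "'a measure"
  assumes flow: "pmp_semiflow \<mu> g"
  shows "sets (invariant_algebra \<mu> g) = {B \<in> sets \<mu>. \<forall>t\<ge>0. AE z in \<mu>. g t z \<in> B \<longleftrightarrow> z \<in> B}"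
    and "subalgebra \<mu> (invariant_algebra \<mu> g)"
proof -
  have g[measurable]: "g t \<in> measurable \<mu> \<mu>" if "0 \<le> t" for t using flow that by (simp add: pmp_semiflow_def)
  let ?X = "{B \<in> sets \<mu>. \<forall>t\<ge>0. AE z in \<mu>. g t z \<in> B \<longleftrightarrow> z \<in> B}"
  have null: "sym_diff (g t -` B \<inter> space \<mu>) B \<in> null_sets \<mu> \<longleftrightarrow> (AE z in \<mu>. g t z \<in> B \<longleftrightarrow> z \<in> B)"
    if B: "B \<in> sets \<mu>" and t: "0 \<le> t" for B t
  proof -
    have "sym_diff (g t -` B \<inter> space \<mu>) B \<in> sets \<mu>" using measurable_sets[OF g[OF t] B] B by auto
    moreover have "{z \<in> space \<mu>. \<not> (g t z \<in> B \<longleftrightarrow> z \<in> B)} = sym_diff (g t -` B \<inter> space \<mu>) B"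
      using sets.sets_into_space[OF B] by auto
    ultimately show ?thesis by (subst AE_iff_null) auto
  qed
  have X: "{B \<in> sets \<mu>. \<forall>t\<ge>0. sym_diff (g t -` B \<inter> space \<mu>) B \<in> null_sets \<mu>} = ?X"
    using null by blast
  have "sigma_algebra (space \<mu>) ?X"
    unfolding sigma_algebra_iff2
  proof (intro conjI ballI allI impI)
    fix B assume B: "B \<in> ?X"
    have "AE z in \<mu>. g t z \<in> space \<mu> - B \<longleftrightarrow> z \<in> space \<mu> - B" if t: "0 \<le> t" for t
    proof -
      have "AE z in \<mu>. g t z \<in> B \<longleftrightarrow> z \<in> B" using B t by auto
      then show ?thesis using AE_space
      proof eventually_elim
        case (elim z)
        then show ?case using measurable_space[OF g[OF t]] by blast
      qed
    qed
    then show "space \<mu> - B \<in> ?X" using B by auto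
  next
    fix A :: "nat \<Rightarrow> 'a set" assume A: "range A \<subseteq> ?X"
    have "AE z in \<mu>. g t z \<in> (\<Union>i. A i) \<longleftrightarrow> z \<in> (\<Union>i. A i)" if t: "0 \<le> t" for t
    proof -
      have "AE z in \<mu>. \<forall>i. g t z \<in> A i \<longleftrightarrow> z \<in> A i" using A t by (subst AE_all_countable) auto
      then show ?thesis by eventually_elim auto
    qed
    then show "(\<Union>i. A i) \<in> ?X" using A by auto
  qed (auto dest: sets.sets_into_space)
  then interpret X: sigma_algebra "space \<mu>" ?X .
  show s: "sets (invariant_algebra \<mu> g) = ?X"
    unfolding invariant_algebra_def X by (rule X.sets_measure_of_eq)
  show "subalgebra \<mu> (invariant_algebra \<mu> g)"
    using s X.space_closed by (auto simp: subalgebra_def invariant_algebra_def X space_measure_of)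
qed

text \<open>Jensen's inequality for the square.\<close>

lemma (in prob_space) square_integrable_cond_exp:
  assumes sub: "subalgebra M F" and f: "square_integrable M f"
  shows "square_integrable M (real_cond_exp M F f)"
    and "(\<integral>x. (real_cond_exp M F f x)\<^sup>2 \<partial>M) \<le> (\<integral>x. (f x)\<^sup>2 \<partial>M)"
proof -
  interpret F: finite_measure_subalgebra M F by unfold_locales (rule sub)
  have i2: "integrable M (\<lambda>x. (f x)\<^sup>2)" using f by (simp add: square_integrable_def)
  have "square_integrable M (\<lambda>_. 1)" by (simp add: square_integrable_def)
  from integral_Cauchy_Schwarz(1)[OF f this] have i1: "integrable M f" by simp
  have E2: "integrable M (\<lambda>x. (real_cond_exp M F f x)\<^sup>2)"
    by (rule F.integrable_convex_cond_exp[OF i1, where I = UNIV and q = "\<lambda>x. x\<^sup>2"])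
       (use i2 convex_power2 in auto)
  then show "square_integrable M (real_cond_exp M F f)"
    by (simp add: square_integrable_def)
  have "AE x in M. (real_cond_exp M F f x)\<^sup>2 \<le> real_cond_exp M F (\<lambda>x. (f x)\<^sup>2) x"
    by (rule F.real_cond_exp_jensens_inequality(2)[OF i1, where I = UNIV and q = "\<lambda>x. x\<^sup>2"])
       (use i2 convex_power2 in auto)
  then have "(\<integral>x. (real_cond_exp M F f x)\<^sup>2 \<partial>M) \<le> (\<integral>x. real_cond_exp M F (\<lambda>x. (f x)\<^sup>2) x \<partial>M)"
    by (intro integral_mono_AE E2 F.real_cond_exp_int(1) i2)
  then show "(\<integral>x. (real_cond_exp M F f x)\<^sup>2 \<partial>M) \<le> (\<integral>x. (f x)\<^sup>2 \<partial>M)"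
    using F.real_cond_exp_int(2)[OF i2] by simp
qed

text \<open>It suffices to find, for each \<open>E\<close> in a generator, some invariant weak limit \<open>F E\<close>; it need not be known
to be the conditional expectation. Indeed, for an invariant set \<open>A\<close> the integral of \<open>indicator E \<circ> g t\<close>
over \<open>A\<close> does not depend on \<open>t\<close>, so it equals both the integral of \<open>indicator E\<close> and that of \<open>F E\<close> over
\<open>A\<close>, which characterises \<open>F E\<close> as the conditional expectation. The extension to \<open>L\<^sup>2\<close>
applies \<open>vanishing_from_generator\<close> with \<open>h\<close> fixed, the bound being the Cauchy-Schwarz inequality
together with the contraction property of conditional expectations.\<close>

lemma keplerian_shear_generator:
  assumes flow: "pmp_semiflow \<mu> g"
    and G: "Int_stable G" "G \<subseteq> Pow (space \<mu>)" "sets \<mu> = sigma_sets (space \<mu>) G" "space \<mu> \<in> G"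
    and F: "\<And>E. E \<in> G \<Longrightarrow> F E \<in> borel_measurable (invariant_algebra \<mu> g)"
      "\<And>E z. E \<in> G \<Longrightarrow> \<bar>F E z\<bar> \<le> 1"
    and conv: "\<And>E h. E \<in> G \<Longrightarrow> square_integrable \<mu> h \<Longrightarrow>
      ((\<lambda>t. \<integral>z. indicator E (g t z) * h z \<partial>\<mu>) \<longlongrightarrow> (\<integral>z. F E z * h z \<partial>\<mu>)) at_top"
  shows "keplerian_shear \<mu> g"
  unfolding keplerian_shear_def
proof (intro conjI allI impI flow)
  interpret prob_space \<mu> using flow by (simp add: pmp_semiflow_def)
  have g[measurable]: "g t \<in> measurable \<mu> \<mu>" and dg: "distr \<mu> \<mu> (g t) = \<mu>" if "0 \<le> t" for t
    using flow that by (simp_all add: pmp_semiflow_def)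
  let ?I = "invariant_algebra \<mu> g"
  let ?E = "real_cond_exp \<mu> ?I"
  note I = invariant_algebra[OF flow]
  interpret I: finite_measure_subalgebra \<mu> ?I by unfold_locales (rule I(2))
  have Gs: "E \<in> sets \<mu>" if "E \<in> G" for E using that G(3) by auto
  have one: "square_integrable \<mu> (\<lambda>_. 1)" by (simp add: square_integrable_def)
  have L1: "integrable \<mu> f" if "square_integrable \<mu> f" for f
    using integral_Cauchy_Schwarz(1)[OF that one] by simp
  have ind: "square_integrable \<mu> (indicator A)" if "A \<in> sets \<mu>" for A
    using that one unfolding square_integrable_Lp
    by (intro Lp_space_bound[where f = "indicator A" and g = "\<lambda>_. 1"]) (auto simp: indicator_def)
  have cond: "AE z in \<mu>. ?E (indicator E) z = F E z" if E: "E \<in> G" for E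
  proof (rule I.real_cond_exp_charact)
    show "integrable \<mu> (indicator E :: _ \<Rightarrow> real)" using L1[OF ind[OF Gs[OF E]]] .
    have Fm: "F E \<in> borel_measurable \<mu>" using measurable_from_subalg[OF I(2) F(1)[OF E]] .
    then show "integrable \<mu> (F E)"
      by (rule integrable_const_bound[where B = 1, rotated]) (simp add: F(2)[OF E])
    fix A assume "A \<in> sets ?I"
    then have A[measurable]: "A \<in> sets \<mu>" and inv: "\<And>t. 0 \<le> t \<Longrightarrow> AE z in \<mu>. g t z \<in> A \<longleftrightarrow> z \<in> A"
      unfolding I(1) by auto
    have [measurable]: "E \<in> sets \<mu>" by (rule Gs[OF E])
    have const: "(\<integral>z. indicator E (g t z) * indicator A z \<partial>\<mu>) = (\<integral>z. indicator E z * indicator A z \<partial>\<mu> :: real)"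
      if t: "0 \<le> t" for t
    proof -
      note [measurable] = g[OF t]
      have "(\<integral>z. indicator E (g t z) * indicator A z \<partial>\<mu> :: real) = (\<integral>z. indicator E (g t z) * indicator A (g t z) \<partial>\<mu>)"
        by (rule integral_cong_AE) (use inv[OF t] in \<open>auto elim!: eventually_mono simp: indicator_def\<close>)
      also have "\<dots> = (\<integral>z. indicator E z * indicator A z \<partial>distr \<mu> \<mu> (g t))"
        by (rule integral_distr[symmetric]) auto
      finally show ?thesis by (simp add: dg[OF t])
    qed
    have "((\<lambda>t. \<integral>z. indicator E (g t z) * indicator A z \<partial>\<mu> :: real) \<longlongrightarrow> (\<integral>z. indicator E z * indicator A z \<partial>\<mu>)) at_top"
      by (rule tendsto_eventually, rule eventually_mono[OF eventually_ge_at_top[of 0]]) (rule const)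
    from tendsto_unique[OF _ this conv[OF E ind[OF A]]]
    show "(\<integral>z\<in>A. indicator E z \<partial>\<mu>) = (\<integral>z\<in>A. F E z \<partial>\<mu>)"
      by (simp add: set_lebesgue_integral_def mult.commute)
  qed (rule F(1)[OF E])
  fix f assume f: "square_integrable \<mu> f"
  show "weakly_tends_L2 \<mu> (\<lambda>t. f \<circ> g t) (?E f)"
    unfolding weakly_tends_L2_def
  proof (intro allI impI)
    fix h assume h: "square_integrable \<mu> h"
    define L where "L = (\<lambda>t f. (\<integral>z. f (g t z) * h z \<partial>\<mu>) - (\<integral>z. ?E f z * h z \<partial>\<mu>))"
    have comp: "square_integrable \<mu> (\<lambda>z. f (g t z))" "(\<integral>z. (f (g t z))\<^sup>2 \<partial>\<mu>) = (\<integral>z. (f z)\<^sup>2 \<partial>\<mu>)"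
      if f: "square_integrable \<mu> f" and t: "0 \<le> t" for f t
    proof -
      note [measurable] = g[OF t]
      have [measurable]: "f \<in> borel_measurable \<mu>" using f by (simp add: square_integrable_def)
      have "integrable (distr \<mu> \<mu> (g t)) (\<lambda>z. (f z)\<^sup>2)" using f by (simp add: dg[OF t] square_integrable_def)
      then show "square_integrable \<mu> (\<lambda>z. f (g t z))"
        unfolding square_integrable_def by (subst (asm) integrable_distr_eq) auto
      have "(\<integral>z. (f z)\<^sup>2 \<partial>distr \<mu> \<mu> (g t)) = (\<integral>z. (f (g t z))\<^sup>2 \<partial>\<mu>)"
        by (rule integral_distr) auto
      then show "(\<integral>z. (f (g t z))\<^sup>2 \<partial>\<mu>) = (\<integral>z. (f z)\<^sup>2 \<partial>\<mu>)" by (simp add: dg[OF t])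
    qed
    note CE = square_integrable_cond_exp[OF I(2)]
    have hm[measurable]: "h \<in> borel_measurable \<mu>" using h by (simp add: square_integrable_def)
    interpret L: bounded_functionals \<mu> 2 L "4 * (\<integral>z. (h z)\<^sup>2 \<partial>\<mu>)"
    proof
      fix t :: real and f k
      assume t: "0 \<le> t" and "f \<in> Lp_space 2 \<mu>" "k \<in> Lp_space 2 \<mu>"
      then have f: "square_integrable \<mu> f" and k: "square_integrable \<mu> k" by (auto simp: square_integrable_Lp)
      have "(\<integral>z. ?E (\<lambda>x. f x + k x) z * h z \<partial>\<mu>) = (\<integral>z. ?E f z * h z + ?E k z * h z \<partial>\<mu>)"
        by (rule integral_cong_AE)
           (use I.real_cond_exp_add[OF L1[OF f] L1[OF k]] in \<open>auto elim!: eventually_mono simp: distrib_right\<close>)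
      also have "\<dots> = (\<integral>z. ?E f z * h z \<partial>\<mu>) + (\<integral>z. ?E k z * h z \<partial>\<mu>)"
        by (intro Bochner_Integration.integral_add integral_Cauchy_Schwarz(1) CE(1) f k h)
      finally show "L t (\<lambda>x. f x + k x) = L t f + L t k"
        using integral_Cauchy_Schwarz(1)[OF comp(1)[OF f t] h] integral_Cauchy_Schwarz(1)[OF comp(1)[OF k t] h]
        by (simp add: L_def distrib_right)
    next
      fix t :: real and f and c :: real
      assume t: "0 \<le> t" and "f \<in> Lp_space 2 \<mu>"
      then have f: "square_integrable \<mu> f" by (auto simp: square_integrable_Lp)
      have "(\<integral>z. ?E (\<lambda>x. c * f x) z * h z \<partial>\<mu>) = (\<integral>z. c * (?E f z * h z) \<partial>\<mu>)"
        by (rule integral_cong_AE)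
           (use I.real_cond_exp_cmult[OF L1[OF f], of c] in \<open>auto elim!: eventually_mono\<close>)
      then show "L t (\<lambda>x. c * f x) = c * L t f"
        by (simp add: L_def mult.assoc right_diff_distrib)
    next
      fix t :: real and f
      assume t: "0 \<le> t" and "f \<in> Lp_space 2 \<mu>"
      then have f: "square_integrable \<mu> f" by (auto simp: square_integrable_Lp)
      define a where "a = (\<integral>z. f (g t z) * h z \<partial>\<mu>)"
      define b where "b = (\<integral>z. ?E f z * h z \<partial>\<mu>)"
      define N where "N = (\<integral>z. (f z)\<^sup>2 \<partial>\<mu>) * (\<integral>z. (h z)\<^sup>2 \<partial>\<mu>)"
      have "a\<^sup>2 \<le> N" unfolding a_def N_def
        using integral_Cauchy_Schwarz(2)[OF comp(1)[OF f t] h] by (simp add: comp(2)[OF f t])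
      moreover have "b\<^sup>2 \<le> N"
      proof -
        have "b\<^sup>2 \<le> (\<integral>z. (?E f z)\<^sup>2 \<partial>\<mu>) * (\<integral>z. (h z)\<^sup>2 \<partial>\<mu>)"
          unfolding b_def by (rule integral_Cauchy_Schwarz(2)[OF CE(1)[OF f] h])
        also have "\<dots> \<le> N" unfolding N_def by (intro mult_right_mono CE(2)[OF f]) simp
        finally show ?thesis .
      qed
      \<comment> \<open>the parallelogram law bounds the square of the difference\<close>
      moreover have "(a - b)\<^sup>2 + (a + b)\<^sup>2 = 2 * a\<^sup>2 + 2 * b\<^sup>2" by (simp add: power2_eq_square algebra_simps)
      moreover have "0 \<le> (a + b)\<^sup>2" by simp
      ultimately have "(a - b)\<^sup>2 \<le> 4 * N" by linarith
      then show "\<bar>L t f\<bar> ^ 2 \<le> 4 * (\<integral>z. (h z)\<^sup>2 \<partial>\<mu>) * (\<integral>z. \<bar>f z\<bar> ^ 2 \<partial>\<mu>)"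
        unfolding L_def a_def[symmetric] b_def[symmetric] by (simp add: N_def mult_ac)
    qed simp
    have van: "L.vanishing (indicator E)" if E: "E \<in> G" for E
    proof -
      have "(\<integral>z. ?E (indicator E) z * h z \<partial>\<mu>) = (\<integral>z. F E z * h z \<partial>\<mu>)"
        by (rule integral_cong_AE)
           (use cond[OF E] measurable_from_subalg[OF I(2) F(1)[OF E]] in \<open>auto elim!: eventually_mono\<close>)
      then have "((\<lambda>t. L t (indicator E)) \<longlongrightarrow> 0) at_top"
        using conv[OF E h] unfolding L_def by (simp add: LIM_zero_iff)
      then show ?thesis unfolding L.vanishing_def .
    qed
    have "L.vanishing f"
    proof (rule L.vanishing_from_generator[OF finite_measure_axioms G(1-3) van])
      have "L t (\<lambda>_. 1) = L t (indicator (space \<mu>))" if t: "0 \<le> t" for t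
      proof -
        have "(\<integral>z. ?E (\<lambda>_. 1) z * h z \<partial>\<mu>) = (\<integral>z. ?E (indicator (space \<mu>)) z * h z \<partial>\<mu>)"
        proof (rule integral_cong_AE)
          have "AE z in \<mu>. ?E (\<lambda>_. 1) z = ?E (indicator (space \<mu>)) z"
            by (rule I.real_cond_exp_cong) auto
          then show "AE z in \<mu>. ?E (\<lambda>_. 1) z * h z = ?E (indicator (space \<mu>)) z * h z"
            by eventually_elim simp
        qed auto
        moreover have "(\<integral>z. indicator (space \<mu>) (g t z) * h z \<partial>\<mu>) = (\<integral>z. 1 * h z \<partial>\<mu>)"
          by (rule Bochner_Integration.integral_cong) (use measurable_space[OF g[OF t]] in auto)
        ultimately show ?thesis by (simp add: L_def)
      qed
      then have "\<forall>\<^sub>F t in at_top. L t (indicator (space \<mu>)) = L t (\<lambda>_. 1)"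
        by (intro eventually_mono[OF eventually_ge_at_top[of 0]]) simp
      then show "L.vanishing (\<lambda>_. 1)"
        using van[OF G(4)] unfolding L.vanishing_def by (simp add: tendsto_cong)
    qed (use f in \<open>simp_all add: square_integrable_Lp\<close>)
    then have "((\<lambda>t. L t f) \<longlongrightarrow> 0) at_top" unfolding L.vanishing_def .
    then show "((\<lambda>t. \<integral>z. (f \<circ> g t) z * h z \<partial>\<mu>) \<longlongrightarrow> (\<integral>z. ?E f z * h z \<partial>\<mu>)) at_top"
      unfolding L_def by (simp add: LIM_zero_iff)
  qed
qed

section \<open>Keplerian shear of the fibred flow\<close>

text \<open>For almost every fixed point \<open>z\<close> of the suspension the inner integral over the manifold converges by
\<open>has_mean_speed\<close>, applied to the weight \<open>indicator B y * h (z, y)\<close>; the inner integrals are dominated by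
those of \<open>\<bar>h\<bar>\<close>.\<close>

lemma fibred_flow_shear_rectangle:
  fixes v :: "'m \<Rightarrow> real" and h :: "('a \<times> real) \<times> 'm \<Rightarrow> real"
  assumes erg: "ergodic_system \<nu> T" and \<rho>: "prob_space \<rho>"
    and v[measurable]: "v \<in> borel_measurable \<rho>" and vpos: "\<And>y. 0 < v y"
    and ac: "\<And>B. B \<in> null_sets lborel \<Longrightarrow> v -` B \<inter> space \<rho> \<in> null_sets \<rho>"
    and E: "E \<in> sets (suspension_measure \<nu>)" and B[measurable]: "B \<in> sets \<rho>"
    and h: "integrable (suspension_measure \<nu> \<Otimes>\<^sub>M \<rho>) h"
  shows "((\<lambda>t. \<integral>z. indicator (E \<times> B) (fibred_flow T v t z) * h z \<partial>(suspension_measure \<nu> \<Otimes>\<^sub>M \<rho>))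
    \<longlongrightarrow> (\<integral>z. measure (suspension_measure \<nu>) E * indicator B (snd z) * h z \<partial>(suspension_measure \<nu> \<Otimes>\<^sub>M \<rho>))) at_top"
proof -
  have \<nu>: "prob_space \<nu>" and T: "T \<in> measurable \<nu> \<nu>" using erg by (auto simp: ergodic_system_def)
  let ?S = "suspension_measure \<nu>"
  interpret S: prob_space ?S by (rule prob_space_suspension[OF \<nu>])
  interpret \<rho>: prob_space \<rho> by fact
  interpret pair_prob_space ?S \<rho> ..
  interpret c: prob_space circle by (rule prob_space_circle)
  have [measurable]: "h \<in> borel_measurable (?S \<Otimes>\<^sub>M \<rho>)" using h by auto
  note fl[measurable] = measurable_fibred_flow[OF T v]
  have EB[measurable]: "E \<times> B \<in> sets (?S \<Otimes>\<^sub>M \<rho>)" using E B by simp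
  define J where "J = (\<lambda>t x. \<integral>y. indicator (E \<times> B) (fibred_flow T v t (x, y)) * h (x, y) \<partial>\<rho>)"
  define J0 where "J0 = (\<lambda>x. \<integral>y. measure ?S E * indicator B y * h (x, y) \<partial>\<rho>)"
  have i1: "integrable (?S \<Otimes>\<^sub>M \<rho>) (\<lambda>z. indicator (E \<times> B) (fibred_flow T v t z) * h z)" for t
    by (rule Bochner_Integration.integrable_bound[OF h]) (auto simp: indicator_def)
  have i0: "integrable (?S \<Otimes>\<^sub>M \<rho>) (\<lambda>z. measure ?S E * indicator B (snd z) * h z)"
  proof (rule Bochner_Integration.integrable_bound[OF h])
    show "AE z in ?S \<Otimes>\<^sub>M \<rho>. norm (measure ?S E * indicator B (snd z) * h z) \<le> norm (h z)"
      using S.prob_le_1[of E] by (auto simp: indicator_def abs_mult intro!: mult_left_le_one_le)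
  qed measurable
  have "((\<lambda>t. \<integral>x. J t x \<partial>?S) \<longlongrightarrow> (\<integral>x. J0 x \<partial>?S)) at_top"
  proof (rule integral_dominated_convergence_at_top[where w = "\<lambda>x. \<integral>y. \<bar>h (x, y)\<bar> \<partial>\<rho>"])
    show "J0 \<in> borel_measurable ?S" unfolding J0_def by measurable
    show "J t \<in> borel_measurable ?S" for t unfolding J_def by measurable
    show "integrable ?S (\<lambda>x. \<integral>y. \<bar>h (x, y)\<bar> \<partial>\<rho>)"
      using integrable_fst'[OF integrable_abs[OF h]] .
    have hx: "AE x in ?S. integrable \<rho> (\<lambda>y. h (x, y))" using AE_integrable_fst'[OF h] .
    show "\<forall>\<^sub>F t in at_top. AE x in ?S. norm (J t x) \<le> (\<integral>y. \<bar>h (x, y)\<bar> \<partial>\<rho>)"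
    proof (rule always_eventually, rule allI)
      fix t
      show "AE x in ?S. norm (J t x) \<le> (\<integral>y. \<bar>h (x, y)\<bar> \<partial>\<rho>)"
        using hx AE_integrable_fst'[OF i1[of t]]
      proof eventually_elim
        case (elim x)
        have "norm (J t x) \<le> (\<integral>y. \<bar>indicator (E \<times> B) (fibred_flow T v t (x, y)) * h (x, y)\<bar> \<partial>\<rho>)"
          unfolding J_def real_norm_def by (rule integral_abs_bound)
        also have "\<dots> \<le> (\<integral>y. \<bar>h (x, y)\<bar> \<partial>\<rho>)"
          by (rule integral_mono) (use elim in \<open>auto simp: indicator_def\<close>)
        finally show ?case .
      qed
    qed
    have mean: "AE z in ?S. has_mean (suspension_orbit T E (fst z)) (measure ?S E)"
    proof -
      have "AE x in distr (\<nu> \<Otimes>\<^sub>M circle) \<nu> fst. has_mean (suspension_orbit T E x) (measure ?S E)"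
        unfolding c.distr_pair_fst by (rule suspension_orbit_has_mean[OF erg E])
      then show ?thesis unfolding suspension_measure_def[of \<nu>] by (rule AE_distrD[rotated]) measurable
    qed
    show "AE x in ?S. ((\<lambda>t. J t x) \<longlongrightarrow> J0 x) at_top"
      using mean hx AE_space
    proof eventually_elim
      case (elim z)
      obtain x s where z: "z = (x, s)" by fastforce
      have x: "x \<in> space \<nu>" and s: "0 \<le> s"
        using elim(3) by (auto simp: z suspension_measure_def space_pair_measure space_restrict_space)
      have hz: "integrable \<rho> (\<lambda>y. indicator B y * h (z, y))"
        using integrable_real_mult_indicator[OF B elim(2)] by (simp add: mult.commute)
      have "((\<lambda>t. \<integral>y. (indicator B y * h (z, y)) * suspension_orbit T E x (s + v y * t) \<partial>\<rho>)
          \<longlongrightarrow> measure ?S E * (\<integral>y. indicator B y * h (z, y) \<partial>\<rho>)) at_top"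
        by (rule has_mean_speed[OF borel_measurable_suspension_orbit[OF T E x] _ _ s v vpos ac hz])
           (use elim(1) in \<open>auto simp: z suspension_orbit_def\<close>)
      moreover have "J t z = (\<integral>y. (indicator B y * h (z, y)) * suspension_orbit T E x (s + v y * t) \<partial>\<rho>)" for t
        unfolding J_def z
        by (rule Bochner_Integration.integral_cong)
           (auto simp: fibred_flow_def suspension_flow_frac suspension_orbit_def indicator_def)
      moreover have "J0 z = measure ?S E * (\<integral>y. indicator B y * h (z, y) \<partial>\<rho>)"
        unfolding J0_def by (simp add: mult.assoc)
      ultimately show ?case by simp
    qed
  qed
  moreover have "(\<integral>x. J t x \<partial>?S) = (\<integral>z. indicator (E \<times> B) (fibred_flow T v t z) * h z \<partial>(?S \<Otimes>\<^sub>M \<rho>))" for t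
    using integral_fst'[OF i1[of t]] by (simp add: J_def)
  moreover have "(\<integral>x. J0 x \<partial>?S) = (\<integral>z. measure ?S E * indicator B (snd z) * h z \<partial>(?S \<Otimes>\<^sub>M \<rho>))"
    using integral_fst'[OF i0] by (simp add: J0_def)
  ultimately show ?thesis by simp
qed

text \<open>The limit for the rectangle \<open>E \<times> B\<close> depends only on the coordinate \<open>y\<close>, which the flow fixes, and is
therefore invariant.\<close>

lemma keplerian_shear_fibred_flow:
  fixes v :: "'m \<Rightarrow> real"
  assumes erg: "ergodic_system \<nu> T" and \<rho>: "prob_space \<rho>"
    and v[measurable]: "v \<in> borel_measurable \<rho>" and vpos: "\<And>y. 0 < v y"
    and ac: "\<And>B. B \<in> null_sets lborel \<Longrightarrow> v -` B \<inter> space \<rho> \<in> null_sets \<rho>"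
  shows "keplerian_shear (suspension_measure \<nu> \<Otimes>\<^sub>M \<rho>) (fibred_flow T v)"
proof -
  have \<nu>: "prob_space \<nu>" and T: "T \<in> measurable \<nu> \<nu>" "distr \<nu> \<nu> T = \<nu>"
    using erg by (auto simp: ergodic_system_def)
  let ?S = "suspension_measure \<nu>" and ?\<mu> = "suspension_measure \<nu> \<Otimes>\<^sub>M \<rho>"
  interpret S: prob_space ?S by (rule prob_space_suspension[OF \<nu>])
  interpret \<rho>: prob_space \<rho> by fact
  interpret pair_prob_space ?S \<rho> ..
  have flow: "pmp_semiflow ?\<mu> (fibred_flow T v)"
    by (rule pmp_semiflow_fibred[OF \<nu> T \<rho> v vpos])
  let ?G = "{E \<times> B | E B. E \<in> sets ?S \<and> B \<in> sets \<rho>}"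
  \<comment> \<open>reads \<open>E\<close> and \<open>B\<close> off a rectangle by projection, which fails for the empty rectangle only\<close>
  define F where "F = (\<lambda>X z. if X = {} then 0 else measure ?S (fst ` X) * indicator (snd ` X :: 'm set) (snd (z :: ('a \<times> real) \<times> 'm)) :: real)"
  have F: "F (E \<times> B) z = measure ?S E * indicator B (snd z)" for E B z
    by (cases "E = {} \<or> B = {}") (auto simp: F_def)
  show ?thesis
  proof (rule keplerian_shear_generator[OF flow, where G = ?G and F = F])
    show "Int_stable ?G" by (rule Int_stable_pair_measure_generator)
    show "?G \<subseteq> Pow (space ?\<mu>)" by (auto simp: space_pair_measure dest: sets.sets_into_space)
    show "sets ?\<mu> = sigma_sets (space ?\<mu>) ?G" by (simp add: sets_pair_measure space_pair_measure)
    show "space ?\<mu> \<in> ?G" by (auto simp: space_pair_measure)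
  next
    fix X assume "X \<in> ?G"
    then obtain E B where X: "X = E \<times> B" and E: "E \<in> sets ?S" and B[measurable]: "B \<in> sets \<rho>" by auto
    have "space ?S \<times> B \<in> sets (invariant_algebra ?\<mu> (fibred_flow T v))"
      unfolding invariant_algebra(1)[OF flow]
    proof (intro CollectI conjI allI impI)
      fix t :: real assume "0 \<le> t"
      then have fl: "fibred_flow T v t \<in> measurable ?\<mu> ?\<mu>" using flow by (simp add: pmp_semiflow_def)
      show "AE z in ?\<mu>. fibred_flow T v t z \<in> space ?S \<times> B \<longleftrightarrow> z \<in> space ?S \<times> B"
      proof (rule AE_I2)
        fix z assume "z \<in> space ?\<mu>"
        then show "fibred_flow T v t z \<in> space ?S \<times> B \<longleftrightarrow> z \<in> space ?S \<times> B"
          using measurable_space[OF fl, of z]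
          by (cases z) (auto simp: fibred_flow_def space_pair_measure)
      qed
    qed (use B in simp)
    then have "(\<lambda>z. measure ?S E * indicator (space ?S \<times> B) z) \<in> borel_measurable (invariant_algebra ?\<mu> (fibred_flow T v))"
      by (intro borel_measurable_times borel_measurable_indicator) auto
    moreover have "space (invariant_algebra ?\<mu> (fibred_flow T v)) = space ?\<mu>"
      using invariant_algebra(2)[OF flow] by (simp add: subalgebra_def)
    ultimately show "F X \<in> borel_measurable (invariant_algebra ?\<mu> (fibred_flow T v))"
      unfolding X F by (subst measurable_cong[where g = "\<lambda>z. measure ?S E * indicator (space ?S \<times> B) z"])
        (auto simp: F space_pair_measure indicator_def)
    show "\<bar>F X z\<bar> \<le> 1" for z unfolding X F using S.prob_le_1[of E] by (auto simp: indicator_def)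
    fix h assume h: "square_integrable ?\<mu> h"
    have "square_integrable ?\<mu> (\<lambda>_. 1)" by (simp add: square_integrable_def)
    from integral_Cauchy_Schwarz(1)[OF h this] have "integrable ?\<mu> h" by simp
    from fibred_flow_shear_rectangle[OF erg \<rho> v vpos ac E B this]
    show "((\<lambda>t. \<integral>z. indicator X (fibred_flow T v t z) * h z \<partial>?\<mu>) \<longlongrightarrow> (\<integral>z. F X z * h z \<partial>?\<mu>)) at_top"
      unfolding X F .
  qed
qed

theorem theorem3p1:
  fixes \<A> :: "('m::{t2_space, second_countable_topology}, real ^ 'n) chart set"
    and \<nu> :: "'a measure" and T :: "'a \<Rightarrow> 'a"
    and v :: "'m \<Rightarrow> real"
    and \<mu> :: "(('a \<times> real) \<times> 'm) measure"
  assumes "C1_atlas \<A>"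
    and "ergodic_system \<nu> T"
    and "C1_manifold_fun \<A> v" and "\<And>y. v y > 0"
    and "ac_compatible \<A> \<nu> \<mu>"
    and "Leb_null \<A> (critical_points \<A> v)"
  shows "keplerian_shear \<mu> (fibred_flow T v)"
proof -
  obtain \<rho> where \<rho>: "prob_space \<rho>" "sets \<rho> = sets borel" "\<mu> = suspension_measure \<nu> \<Otimes>\<^sub>M \<rho>"
    and null: "\<And>B. B \<in> sets borel \<Longrightarrow> Leb_null \<A> B \<Longrightarrow> B \<in> null_sets \<rho>"
    using assms(5) unfolding ac_compatible_def by blast
  have v: "v \<in> borel_measurable borel"
    by (rule borel_measurable_continuous_onI[OF C1_manifold_fun_continuous[OF assms(1,3)]])
  have space: "space \<rho> = UNIV" using sets_eq_imp_space_eq[OF \<rho>(2)] by simp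
  have "v -` B \<inter> space \<rho> \<in> null_sets \<rho>" if B: "B \<in> null_sets lborel" for B
  proof -
    have "B \<in> sets borel" using B by auto
    then have "v -` B \<in> sets borel" using measurable_sets[OF v, of B] by simp
    then show ?thesis using null Leb_null_preimage[OF assms(1,3,6) B] by (simp add: space)
  qed
  moreover have "v \<in> borel_measurable \<rho>" using v \<rho>(2) by (simp cong: measurable_cong_sets)
  ultimately show ?thesis
    unfolding \<rho>(3) using assms(2,4) \<rho>(1) by (intro keplerian_shear_fibred_flow) auto
qed

end
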